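(* With $F$ and $H$ the forms defined in the context, where $p=h+3$ and $q=h+4$: for every positive integer $n$ there exist infinitely many integers $h$ such that the system of four simultaneous equations $$\begin{aligned} &x_3=0,\qquad x_4=x_2,\\ &F(x_1,x_2,x_3,x_4)=F(x_5,x_6,x_7,x_8),\\ &F(x_1,x_2,x_3,x_4)\{-x_1^2+3x_2^2+31x_4^2-(x_5-2x_7+2x_8+h(x_6-x_8))^2\}+2hH(x_1,\dots,x_8)=0 \end{aligned}$$ has at least $n$ distinct nonzero integer solutions $(x_1,\dots,x_8)$. Consequently, for every $n$ there are infinitely many integers $h$ such that the pair of simultaneous equations, one of degree 4 and one of degree 6, in the six variables $x_1,x_2,x_5,x_6,x_7,x_8$, obtained by substituting $x_3=0$, $x_4=x_2$ in the last two equations, has at least $n$ distinct nonzero integer solutions.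
   Context: Solutions differing by a nonzero rational scalar factor are regarded as equivalent and counted once. For parameters $p,q$, the quartic form $F$ is $$\begin{aligned} F(x_1,x_2,x_3,x_4)={}&x_1^4-2px_1^3x_3+px_1^2x_2^2-(2p^2-4q)x_1^2x_2x_4+(p^2+2q)x_1^2x_3^2+p(p^2-3q)x_1^2x_4^2\\ &-4qx_1x_2^2x_3+4pqx_1x_2x_3x_4-2pqx_1x_3^3-2q(p^2-2q)x_1x_3x_4^2+qx_2^4-2pqx_2^3x_4\\ &+pqx_2^2x_3^2+q(p^2+2q)x_2^2x_4^2-4q^2x_2x_3^2x_4-2pq^2x_2x_4^3+q^2x_3^4+pq^2x_3^2x_4^2+q^3x_4^4 \end{aligned}$$ (the norm of $x_1+x_2\rho+x_3\rho^2+x_4\rho^3$ where $\rho^4+p\rho^2+q=0$). Consider the relations $$\begin{aligned} x_5&=m_1x_1-qm_4x_2-qm_3x_3-q(m_2-pm_4)x_4,\\ x_6&=m_2x_1+m_1x_2-qm_4x_3-qm_3x_4,\\ x_7&=m_3x_1+(m_2-pm_4)x_2+(m_1-pm_3)x_3-\{pm_2-(p^2-q)m_4\}x_4,\\ x_8&=m_4x_1+m_3x_2+(m_2-pm_4)x_3+(m_1-pm_3)x_4. \end{aligned}$$ Viewed as a linear system in $m_1,\dots,m_4$ this is $A\,(m_1,m_2,m_3,m_4)^T=(x_5,x_6,x_7,x_8)^T$ with $$A=\begin{pmatrix}x_1&-qx_4&-qx_3&-qx_2+pqx_4\\ x_2&x_1&-qx_4&-qx_3\\ x_3&x_2-px_4&x_1-px_3&-px_2+(p^2-q)x_4\\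 x_4&x_3&x_2-px_4&x_1-px_3\end{pmatrix},\qquad \det A=F(x_1,x_2,x_3,x_4).$$ The quartic forms $G_1,\dots,G_4$ in $x_1,\dots,x_8$ are those obtained by solving this system, i.e. determined by the identities $G_j(x_1,\dots,x_8)=m_jF(x_1,x_2,x_3,x_4)$, $j=1,2,3,4$, holding identically in $x_1,\dots,x_4,m_1,\dots,m_4$ when $x_5,x_6,x_7,x_8$ are given by $(x_5,x_6,x_7,x_8)^T=A\,(m_1,m_2,m_3,m_4)^T$; equivalently $(G_1,G_2,G_3,G_4)^T=\mathrm{adj}(A)\,(x_5,x_6,x_7,x_8)^T$. Then $$\begin{aligned} H(x_1,\dots,x_8)={}&(-2x_5x_6+3x_6^2+2px_6x_7-3px_6x_8-2qx_7x_8+3qx_8^2)G_1\\ &+(2x_5^2-3x_5x_6-2px_5x_7+3px_5x_8+2qx_7^2-3qx_7x_8)G_2\\ &+2q(x_5x_8-x_6x_7)G_3-3q(x_5x_8-x_6x_7)G_4. \end{aligned}$$ *)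

theory Defs
  imports
    "Jordan_Normal_Form.Determinant"
    "HOL-Library.Poly_Mapping"
begin

text \<open>
  All forms are defined over an arbitrary commutative ring, so that the same formula can be
  evaluated at integers and at the indeterminates of a polynomial ring (where its total degree
  makes sense).
\<close>

definition F_form :: "'a::comm_ring_1 \<Rightarrow> 'a \<Rightarrow> 'a \<Rightarrow> 'a \<Rightarrow> 'a \<Rightarrow> 'a \<Rightarrow> 'a" where
  "F_form p q x1 x2 x3 x4 =
     x1^4 - 2*p*x1^3*x3 + p*x1^2*x2^2 - (2*p^2 - 4*q)*x1^2*x2*x4 + (p^2 + 2*q)*x1^2*x3^2
     + p*(p^2 - 3*q)*x1^2*x4^2
     - 4*q*x1*x2^2*x3 + 4*p*q*x1*x2*x3*x4 - 2*p*q*x1*x3^3 - 2*q*(p^2 - 2*q)*x1*x3*x4^2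
     + q*x2^4 - 2*p*q*x2^3*x4
     + p*q*x2^2*x3^2 + q*(p^2 + 2*q)*x2^2*x4^2 - 4*q^2*x2*x3^2*x4 - 2*p*q^2*x2*x4^3
     + q^2*x3^4 + p*q^2*x3^2*x4^2 + q^3*x4^4"

definition A_mat :: "'a::comm_ring_1 \<Rightarrow> 'a \<Rightarrow> 'a \<Rightarrow> 'a \<Rightarrow> 'a \<Rightarrow> 'a \<Rightarrow> 'a mat" where
  "A_mat p q x1 x2 x3 x4 = mat_of_rows_list 4
     [[x1, - q*x4,    - q*x3,    - q*x2 + p*q*x4],
      [x2, x1,        - q*x4,    - q*x3],
      [x3, x2 - p*x4, x1 - p*x3, - p*x2 + (p^2 - q)*x4],
      [x4, x3,        x2 - p*x4, x1 - p*x3]]"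

text \<open>The vector with (0-based) entries \<open>G\<^sub>1, \<dots>, G\<^sub>4\<close>.\<close>

definition G_vec ::
  "'a::comm_ring_1 \<Rightarrow> 'a \<Rightarrow> 'a \<Rightarrow> 'a \<Rightarrow> 'a \<Rightarrow> 'a \<Rightarrow> 'a \<Rightarrow> 'a \<Rightarrow> 'a \<Rightarrow> 'a \<Rightarrow> 'a vec" where
  "G_vec p q x1 x2 x3 x4 x5 x6 x7 x8 =
     adj_mat (A_mat p q x1 x2 x3 x4) *\<^sub>v vec_of_list [x5, x6, x7, x8]"

definition H_form ::
  "'a::comm_ring_1 \<Rightarrow> 'a \<Rightarrow> 'a \<Rightarrow> 'a \<Rightarrow> 'a \<Rightarrow> 'a \<Rightarrow> 'a \<Rightarrow> 'a \<Rightarrow> 'a \<Rightarrow> 'a \<Rightarrow> 'a" where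
  "H_form p q x1 x2 x3 x4 x5 x6 x7 x8 =
     (let G = G_vec p q x1 x2 x3 x4 x5 x6 x7 x8;
          G1 = G $ 0; G2 = G $ 1; G3 = G $ 2; G4 = G $ 3
      in (- 2*x5*x6 + 3*x6^2 + 2*p*x6*x7 - 3*p*x6*x8 - 2*q*x7*x8 + 3*q*x8^2) * G1
         + (2*x5^2 - 3*x5*x6 - 2*p*x5*x7 + 3*p*x5*x8 + 2*q*x7^2 - 3*q*x7*x8) * G2
         + 2*q*(x5*x8 - x6*x7) * G3
         - 3*q*(x5*x8 - x6*x7) * G4)"

text \<open>
  Left-hand sides of the two main equations (the quartic one written as a difference),
  for \<open>p = h + 3\<close> and \<open>q = h + 4\<close>.
\<close>

definition quartic_lhs ::
  "'a::comm_ring_1 \<Rightarrow> 'a \<Rightarrow> 'a \<Rightarrow> 'a \<Rightarrow> 'a \<Rightarrow> 'a \<Rightarrow> 'a \<Rightarrow> 'a \<Rightarrow> 'a \<Rightarrow> 'a" where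
  "quartic_lhs h x1 x2 x3 x4 x5 x6 x7 x8 =
     F_form (h + 3) (h + 4) x1 x2 x3 x4 - F_form (h + 3) (h + 4) x5 x6 x7 x8"

definition sextic_lhs ::
  "'a::comm_ring_1 \<Rightarrow> 'a \<Rightarrow> 'a \<Rightarrow> 'a \<Rightarrow> 'a \<Rightarrow> 'a \<Rightarrow> 'a \<Rightarrow> 'a \<Rightarrow> 'a \<Rightarrow> 'a" where
  "sextic_lhs h x1 x2 x3 x4 x5 x6 x7 x8 =
     F_form (h + 3) (h + 4) x1 x2 x3 x4
       * (- (x1^2) + 3*x2^2 + 31*x4^2 - (x5 - 2*x7 + 2*x8 + h*(x6 - x8))^2)
     + 2*h * H_form (h + 3) (h + 4) x1 x2 x3 x4 x5 x6 x7 x8"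

definition quartic6 ::
  "'a::comm_ring_1 \<Rightarrow> 'a \<Rightarrow> 'a \<Rightarrow> 'a \<Rightarrow> 'a \<Rightarrow> 'a \<Rightarrow> 'a \<Rightarrow> 'a" where
  "quartic6 h x1 x2 x5 x6 x7 x8 = quartic_lhs h x1 x2 0 x2 x5 x6 x7 x8"

definition sextic6 ::
  "'a::comm_ring_1 \<Rightarrow> 'a \<Rightarrow> 'a \<Rightarrow> 'a \<Rightarrow> 'a \<Rightarrow> 'a \<Rightarrow> 'a \<Rightarrow> 'a" where
  "sextic6 h x1 x2 x5 x6 x7 x8 = sextic_lhs h x1 x2 0 x2 x5 x6 x7 x8"

definition system8_solutions :: "int \<Rightarrow> int vec set" where
  "system8_solutions h = {vec_of_list [x1, x2, x3, x4, x5, x6, x7, x8] | x1 x2 x3 x4 x5 x6 x7 x8.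
     x3 = 0 \<and> x4 = x2 \<and>
     F_form (h + 3) (h + 4) x1 x2 x3 x4 = F_form (h + 3) (h + 4) x5 x6 x7 x8 \<and>
     sextic_lhs h x1 x2 x3 x4 x5 x6 x7 x8 = 0}"

definition system6_solutions :: "int \<Rightarrow> int vec set" where
  "system6_solutions h = {vec_of_list [x1, x2, x5, x6, x7, x8] | x1 x2 x5 x6 x7 x8.
     quartic6 h x1 x2 x5 x6 x7 x8 = 0 \<and> sextic6 h x1 x2 x5 x6 x7 x8 = 0}"

text \<open>Solutions differing by a nonzero rational factor count once.\<close>

definition rat_proportional :: "int vec \<Rightarrow> int vec \<Rightarrow> bool" where
  "rat_proportional v w \<longleftrightarrow>
     (\<exists>r::rat. r \<noteq> 0 \<and> map_vec rat_of_int w = r \<cdot>\<^sub>v map_vec rat_of_int v)"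

definition at_least_distinct_nonzero :: "nat \<Rightarrow> int vec set \<Rightarrow> bool" where
  "at_least_distinct_nonzero n Sol \<longleftrightarrow>
     (\<exists>S \<subseteq> Sol. finite S \<and> card S = n \<and> (\<forall>v\<in>S. v \<noteq> 0\<^sub>v (dim_vec v)) \<and>
        pairwise (\<lambda>v w. \<not> rat_proportional v w) S)"

text \<open>
  Multivariate integer polynomials: finitely supported maps from monomials (finitely supported
  exponent vectors) to coefficients, with the convolution product of the library.
\<close>

type_synonym int_mpoly = "(nat \<Rightarrow>\<^sub>0 nat) \<Rightarrow>\<^sub>0 int"

definition X_var :: "nat \<Rightarrow> int_mpoly" where
  "X_var i = Poly_Mapping.single (Poly_Mapping.single i 1) 1"

definition total_deg :: "int_mpoly \<Rightarrow> nat" where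
  "total_deg P = Max (insert 0 ((\<lambda>m. \<Sum>i\<in>Poly_Mapping.keys m. Poly_Mapping.lookup m i) ` Poly_Mapping.keys P))"

lemma A_mat_carrier [simp]: "A_mat p q x1 x2 x3 x4 \<in> carrier_mat 4 4"
  by (intro carrier_matI) (simp_all add: A_mat_def mat_of_rows_list_def)

lemma A_mat_mult_vec:
  fixes p q :: "'a::comm_ring_1"
  shows
  "A_mat p q x1 x2 x3 x4 *\<^sub>v vec_of_list [m1, m2, m3, m4] = vec_of_list
     [m1*x1 - q*m4*x2 - q*m3*x3 - q*(m2 - p*m4)*x4,
      m2*x1 + m1*x2 - q*m4*x3 - q*m3*x4,
      m3*x1 + (m2 - p*m4)*x2 + (m1 - p*m3)*x3 - (p*m2 - (p^2 - q)*m4)*x4,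
      m4*x1 + m3*x2 + (m2 - p*m4)*x3 + (m1 - p*m3)*x4]"
  (is "?l = ?r")
proof (rule eq_vecI)
  fix i assume "i < dim_vec ?r"
  then have "i = 0 \<or> i = 1 \<or> i = 2 \<or> i = 3" by auto
  then show "?l $ i = ?r $ i"
    by (elim disjE)
       (simp_all add: A_mat_def mat_of_rows_list_def scalar_prod_def vec_of_list_index
          numeral_2_eq_2 numeral_3_eq_3 algebra_simps del: vec_of_list_Cons)
qed (simp add: A_mat_def mat_of_rows_list_def)

lemma det_A_mat:
  fixes p q :: "'a::comm_ring_1"
  shows "det (A_mat p q x1 x2 x3 x4) = F_form p q x1 x2 x3 x4"
proof -
  have *: "det (A_mat p q x1 x2 x3 x4)
      = (\<Sum>j<4. A_mat p q x1 x2 x3 x4 $$ (0,j) * cofactor (A_mat p q x1 x2 x3 x4) 0 j)"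
    by (rule laplace_expansion_row[OF A_mat_carrier]) simp
  have d2: "det B = B $$ (0,0) * B $$ (1,1) - B $$ (0,1) * B $$ (1,0)"
    if B: "B \<in> carrier_mat 2 2" for B :: "'a mat"
  proof -
    have exp: "det B = (\<Sum>j<2. B $$ (0,j) * cofactor B 0 j)"
      by (rule laplace_expansion_row[OF B]) simp
    have minor: "det (mat_delete B 0 j) = mat_delete B 0 j $$ (0,0)" for j
      by (rule det_single) (use B in \<open>auto simp: mat_delete_def\<close>)
    show ?thesis unfolding exp cofactor_def minor using B
      by (simp add: mat_delete_def lessThan_Suc numeral_eq_Suc)
  qed
  have d3: "det B = B $$ (0,0) * (B $$ (1,1) * B $$ (2,2) - B $$ (1,2) * B $$ (2,1))
      - B $$ (0,1) * (B $$ (1,0) * B $$ (2,2) - B $$ (1,2) * B $$ (2,0))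
      + B $$ (0,2) * (B $$ (1,0) * B $$ (2,1) - B $$ (1,1) * B $$ (2,0))"
    if B: "B \<in> carrier_mat 3 3" for B :: "'a mat"
  proof -
    have exp: "det B = (\<Sum>j<3. B $$ (0,j) * cofactor B 0 j)"
      by (rule laplace_expansion_row[OF B]) simp
    have minor: "det (mat_delete B 0 j) = mat_delete B 0 j $$ (0,0) * mat_delete B 0 j $$ (1,1)
       - mat_delete B 0 j $$ (0,1) * mat_delete B 0 j $$ (1,0)" for j
      by (rule d2) (use B in \<open>auto simp: mat_delete_def\<close>)
    show ?thesis unfolding exp cofactor_def minor using B
      by (simp add: mat_delete_def lessThan_Suc numeral_eq_Suc algebra_simps)
  qed
  have c: "det (mat_delete (A_mat p q x1 x2 x3 x4) 0 j) =
     (let B = mat_delete (A_mat p q x1 x2 x3 x4) 0 j in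
      B $$ (0,0) * (B $$ (1,1) * B $$ (2,2) - B $$ (1,2) * B $$ (2,1))
      - B $$ (0,1) * (B $$ (1,0) * B $$ (2,2) - B $$ (1,2) * B $$ (2,0))
      + B $$ (0,2) * (B $$ (1,0) * B $$ (2,1) - B $$ (1,1) * B $$ (2,0)))" for j
    unfolding Let_def
    by (rule d3) (auto simp: mat_delete_def A_mat_def mat_of_rows_list_def)
  show ?thesis
    unfolding * cofactor_def c
    by (simp add: Let_def F_form_def mat_delete_def A_mat_def mat_of_rows_list_def
        lessThan_Suc numeral_eq_Suc)
       (simp add: algebra_simps)
qed

lemma G_vec_identity:
  assumes "vec_of_list [x5, x6, x7, x8]
    = A_mat p q x1 x2 x3 x4 *\<^sub>v vec_of_list [m1, m2, m3, m4]"
  shows "G_vec p q x1 x2 x3 x4 x5 x6 x7 x8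
    = F_form p q x1 x2 x3 x4 \<cdot>\<^sub>v vec_of_list [m1, m2, m3, m4]"
proof -
  let ?A = "A_mat p q x1 x2 x3 x4" and ?m = "vec_of_list [m1, m2, m3, m4]"
  have m: "?m \<in> carrier_vec 4"
    by (rule carrier_vecI) simp
  have "G_vec p q x1 x2 x3 x4 x5 x6 x7 x8 = adj_mat ?A *\<^sub>v (?A *\<^sub>v ?m)"
    using assms by (simp only: G_vec_def)
  also have "\<dots> = (adj_mat ?A * ?A) *\<^sub>v ?m"
    using assoc_mult_mat_vec[OF adj_mat(1)[OF A_mat_carrier] A_mat_carrier m] by simp
  also have "\<dots> = (F_form p q x1 x2 x3 x4 \<cdot>\<^sub>m 1\<^sub>m 4) *\<^sub>v ?m"
    by (simp only: adj_mat(3)[OF A_mat_carrier] det_A_mat)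
  also have "\<dots> = F_form p q x1 x2 x3 x4 \<cdot>\<^sub>v ?m"
    by (rule eq_vecI) (use m in auto)
  finally show ?thesis .
qed

end

theory Submission
  imports Defs Complex_Main
begin

text \<open>
  Let K = \<rat>(\<rho>) with \<rho>^4 + p\<rho>^2 + q = 0, where p = h+3 and q = h+4, let
  \<theta> = \<rho>^2 and k = \<rat>(\<theta>).  A vector (y1,\<dots>,y4) stands for
  y1 + y2\<rho> + y3\<rho>^2 + y4\<rho>^3, so that F is the norm from K to \<rat>, and the
  conditions x3 = 0, x4 = x2 say that \<alpha> = x1 + x2(\<rho> + \<rho>^3).

  If y = m\<alpha> and m has relative norm 1 over k, then F(x) = F(y), and after division by
  F the sextic equation becomes the quadratic equation
  - x1^2 + 34 x2^2 - L(y)^2 + 2 h x2 M(y) = 0 with linear forms L, M (\<open>H_form_reduce\<close>).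
  The surface of all these pairs (\<alpha>, y) has two involutions.  One replaces x1 by
  - x1 and keeps y: only the relative norm of \<alpha> matters, and it is even in x1.  The
  other keeps m: then the equation is quadratic in (x1 : x2) and its second root is rational as
  well.  Their composition (\<open>point_step\<close>), iterated from the obvious solution
  \<alpha> = y = 3 + \<rho> + \<rho>^3, yields the solutions.

  That the iterates differ is seen by letting h tend to infinity.  Normalise x2 = 1.  Along the
  orbit, x1 is alternately bounded and of exact order h; if at a bounded step
  x1 \<rightarrow> A, then x1 / h \<rightarrow> B at the next one for some B > 0, and
  x1 \<rightarrow> A + 4B at the one after that (\<open>even_to_odd\<close>, \<open>odd_to_even\<close>).  The limits A thus
  form a strictly increasing sequence.  Given n, choose n of them: for all large h the
  corresponding n solutions have different ratios x1 : x2, and clearing denominators turns them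
  into n integer solutions none of which is a multiple of another.

  The degrees 4 and 6 come from the terms x1^4 and - x1^6, together with the upper bounds that
  the shape of the forms gives.
\<close>

section \<open>The norm form\<close>

text \<open>
  The relative norm of a + b\<rho> + c\<rho>^2 + d\<rho>^3 from K to k, that is
  (a + c\<theta>)^2 - \<theta> (b + d\<theta>)^2, written as \<open>rel_norm_const + rel_norm_theta\<close> \<theta>.
\<close>

definition rel_norm_const :: "real \<Rightarrow> real \<Rightarrow> real \<Rightarrow> real \<Rightarrow> real \<Rightarrow> real \<Rightarrow> real" where
  "rel_norm_const p q a b c d = a^2 - q*c^2 + q*(2*b*d - p*d^2)"
definition rel_norm_theta :: "real \<Rightarrow> real \<Rightarrow> real \<Rightarrow> real \<Rightarrow> real \<Rightarrow> real \<Rightarrow> real" where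
  "rel_norm_theta p q a b c d = 2*a*c - p*c^2 - (b^2 - q*d^2) + p*(2*b*d - p*d^2)"

lemma F_form_eq_rel_norm:
  "F_form p q a b c d = rel_norm_const p q a b c d ^ 2 - p * rel_norm_const p q a b c d * rel_norm_theta p q a b c d
     + q * rel_norm_theta p q a b c d ^ 2"
  unfolding F_form_def rel_norm_const_def rel_norm_theta_def by Groebner_Basis.algebra

text \<open>
  The equation y = m (x1 + x2(\<rho> + \<rho>^3)) for p = h + 3, q = h + 4.
\<close>

definition line_multiple :: "'a::comm_ring_1 \<Rightarrow> 'a \<Rightarrow> 'a \<Rightarrow> 'a \<Rightarrow> 'a \<Rightarrow> 'a \<Rightarrow> 'a \<Rightarrow> 'a \<Rightarrow> 'a \<Rightarrow> 'a \<Rightarrow> 'a \<Rightarrow> bool" where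
  "line_multiple h x1 x2 m1 m2 m3 m4 y1 y2 y3 y4 \<longleftrightarrow>
     y1 = x1*m1 + x2*(- (h+4)*m2 + (h+4)*(h+2)*m4) \<and>
     y2 = x1*m2 + x2*(m1 - (h+4)*m3) \<and>
     y3 = x1*m3 + x2*(- (h+2)*m2 + (h^2+4*h+2)*m4) \<and>
     y4 = x1*m4 + x2*(m1 - (h+2)*m3)"

text \<open>
  The relative norm is multiplicative, and \<theta>^2 = - p\<theta> - q: this and the next lemma are the
  two coefficients of a product in k.
\<close>

lemma rel_norm_const_mult:
  fixes h :: "real"
  assumes "line_multiple h x1 x2 m1 m2 m3 m4 y1 y2 y3 y4"
  defines "p \<equiv> h + 3" and "q \<equiv> h + 4"
  shows "rel_norm_const p q y1 y2 y3 y4 = rel_norm_const p q m1 m2 m3 m4 * rel_norm_const p q x1 x2 0 x2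
           - q * rel_norm_theta p q m1 m2 m3 m4 * rel_norm_theta p q x1 x2 0 x2"
proof -
  have y: "y1 = x1*m1 + x2*(- (h+4)*m2 + (h+4)*(h+2)*m4)" "y2 = x1*m2 + x2*(m1 - (h+4)*m3)"
     "y3 = x1*m3 + x2*(- (h+2)*m2 + (h^2+4*h+2)*m4)" "y4 = x1*m4 + x2*(m1 - (h+2)*m3)"
    using assms(1) by (auto simp: line_multiple_def)
  show ?thesis unfolding p_def q_def rel_norm_const_def rel_norm_theta_def y by (simp only: power2_eq_square) Groebner_Basis.algebra
qed

lemma rel_norm_theta_mult:
  fixes h :: "real"
  assumes "line_multiple h x1 x2 m1 m2 m3 m4 y1 y2 y3 y4"
  defines "p \<equiv> h + 3" and "q \<equiv> h + 4"
  shows "rel_norm_theta p q y1 y2 y3 y4 = rel_norm_const p q m1 m2 m3 m4 * rel_norm_theta p q x1 x2 0 x2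
           + rel_norm_theta p q m1 m2 m3 m4 * rel_norm_const p q x1 x2 0 x2
           - p * rel_norm_theta p q m1 m2 m3 m4 * rel_norm_theta p q x1 x2 0 x2"
proof -
  have y: "y1 = x1*m1 + x2*(- (h+4)*m2 + (h+4)*(h+2)*m4)" "y2 = x1*m2 + x2*(m1 - (h+4)*m3)"
     "y3 = x1*m3 + x2*(- (h+2)*m2 + (h^2+4*h+2)*m4)" "y4 = x1*m4 + x2*(m1 - (h+2)*m3)"
    using assms(1) by (auto simp: line_multiple_def)
  show ?thesis unfolding p_def q_def rel_norm_const_def rel_norm_theta_def y by (simp only: power2_eq_square) Groebner_Basis.algebra
qed

definition form_L :: "real \<Rightarrow> real \<Rightarrow> real \<Rightarrow> real \<Rightarrow> real \<Rightarrow> real" where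
  "form_L h y1 y2 y3 y4 = y1 - 2*y3 + 2*y4 + h*(y2 - y4)"
definition form_M :: "real \<Rightarrow> real \<Rightarrow> real \<Rightarrow> real \<Rightarrow> real" where
  "form_M y1 y2 y3 y4 = 3*(y2 + y4) - 2*(y1 + y3)"

text \<open>
  Write \<nu> = rel_norm(m) and split \<alpha> = Ae + Ao \<rho>, y = E + O\<rho> and
  m = Me + Mo\<rho> over k.  The left-hand side is the constant coefficient of
  (3conj(O) - 2conj(E))(O Me - E Mo), and O Me - E Mo = \<nu> Ao by y = m\<alpha>.  With
  \<nu> = 1, Ao = x2 (1 + \<theta>) and q - p = 1, what remains is linear in y.
\<close>

lemma H_form_reduce:
  fixes h :: "real"
  assumes "line_multiple h x1 x2 m1 m2 m3 m4 y1 y2 y3 y4"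
  defines "p \<equiv> h + 3" and "q \<equiv> h + 4"
  assumes "rel_norm_const p q m1 m2 m3 m4 = 1" "rel_norm_theta p q m1 m2 m3 m4 = 0"
  shows "(- 2*y1*y2 + 3*y2^2 + 2*p*y2*y3 - 3*p*y2*y4 - 2*q*y3*y4 + 3*q*y4^2) * m1
         + (2*y1^2 - 3*y1*y2 - 2*p*y1*y3 + 3*p*y1*y4 + 2*q*y3^2 - 3*q*y3*y4) * m2
         + 2*q*(y1*y4 - y2*y3) * m3 - 3*q*(y1*y4 - y2*y3) * m4 = x2 * form_M y1 y2 y3 y4"
proof -
  have y: "y1 = x1*m1 + x2*(- (h+4)*m2 + (h+4)*(h+2)*m4)" "y2 = x1*m2 + x2*(m1 - (h+4)*m3)"
     "y3 = x1*m3 + x2*(- (h+2)*m2 + (h^2+4*h+2)*m4)" "y4 = x1*m4 + x2*(m1 - (h+2)*m3)"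
    using assms(1) by (auto simp: line_multiple_def)
  define N T where "N = rel_norm_const p q m1 m2 m3 m4" and "T = rel_norm_theta p q m1 m2 m3 m4"
  define A C where "A = 3*y2 - 2*y1" and "C = 3*y4 - 2*y3"
  have "(- 2*y1*y2 + 3*y2^2 + 2*p*y2*y3 - 3*p*y2*y4 - 2*q*y3*y4 + 3*q*y4^2) * m1
         + (2*y1^2 - 3*y1*y2 - 2*p*y1*y3 + 3*p*y1*y4 + 2*q*y3^2 - 3*q*y3*y4) * m2
         + 2*q*(y1*y4 - y2*y3) * m3 - 3*q*(y1*y4 - y2*y3) * m4
        = x2 * (N * (A + C) - q * T * (A - C))"
    unfolding N_def T_def A_def C_def p_def q_def rel_norm_const_def rel_norm_theta_def y by Groebner_Basis.algebra
  then show ?thesis using assms(4,5) by (simp add: N_def T_def A_def C_def form_M_def algebra_simps)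
qed

section \<open>Rational points and the step between them\<close>

text \<open>
  A rational point of the surface, normalised by x2 = 1; the number 34 is 3 + 31, since
  x4 = x2.
\<close>

definition point :: "real \<Rightarrow> real \<Rightarrow> real \<Rightarrow> real \<Rightarrow> real \<Rightarrow> real \<Rightarrow> bool" where
  "point h x y1 y2 y3 y4 \<longleftrightarrow> x \<in> \<rat> \<and> y1 \<in> \<rat> \<and> y2 \<in> \<rat> \<and> y3 \<in> \<rat> \<and> y4 \<in> \<rat> \<and>
     (\<exists>m1 m2 m3 m4. line_multiple h x 1 m1 m2 m3 m4 y1 y2 y3 y4 \<and>
        rel_norm_const (h+3) (h+4) m1 m2 m3 m4 = 1 \<and> rel_norm_theta (h+3) (h+4) m1 m2 m3 m4 = 0) \<and>
     - (x^2) + 34 - (form_L h y1 y2 y3 y4)^2 + 2*h * form_M y1 y2 y3 y4 = 0"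

lemma F_line_pos:
  fixes h x1 x2 :: real
  assumes "h \<ge> 2" "x2 \<noteq> 0"
  shows "F_form (h+3) (h+4) x1 x2 0 x2 > 0"
proof -
  have e: "F_form (h+3) (h+4) x1 x2 0 x2
     = x1^4 + (h^3 + 4*h^2 - h - 8) * (x1^2 * x2^2) + 4*(h+4)*x2^4"
    unfolding F_form_def
    by (simp add: algebra_simps power2_eq_square power3_eq_cube power4_eq_xxxx)
  have "h^2 \<ge> 4" using power_mono[of 2 h 2] assms by simp
  moreover have "h^3 = h * h^2" by (simp add: power3_eq_cube power2_eq_square)
  moreover have "h * h^2 \<ge> h * 4" using assms \<open>h^2 \<ge> 4\<close> by (intro mult_left_mono) auto
  ultimately have "h^3 + 4*h^2 - h - 8 \<ge> 0" using assms by linarith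
  then have "(h^3 + 4*h^2 - h - 8) * (x1^2 * x2^2) \<ge> 0" by (intro mult_nonneg_nonneg) auto
  moreover have "4*(h+4)*x2^4 > 0" using assms by simp
  moreover have "x1^4 \<ge> 0" by simp
  ultimately show ?thesis unfolding e by linarith
qed

text \<open>
  An element N + T\<theta> of k that fixes U + V\<theta> under multiplication is 1, provided that
  U + V\<theta> has nonzero norm.
\<close>

lemma rel_norm_cancel:
  fixes p q U V N T :: real
  assumes "U^2 - p*U*V + q*V^2 \<noteq> 0" "N*U - q*T*V = U" "N*V + T*U - p*T*V = V"
  shows "N = 1" "T = 0"
proof -
  have "(N - 1) * (U^2 - p*U*V + q*V^2)
      = (N*U - q*T*V - U) * (U - p*V) + (N*V + T*U - p*T*V - V) * (q*V)"
    by (simp add: algebra_simps power2_eq_square)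
  then show "N = 1" using assms by simp
  have "T * (U^2 - p*U*V + q*V^2)
      = (N*V + T*U - p*T*V - V) * U - (N*U - q*T*V - U) * V"
    by (simp add: algebra_simps power2_eq_square)
  then show "T = 0" using assms by simp
qed

text \<open>
  The values of the two linear forms at m(\<rho> + \<rho>^3).  With them the quadratic equation for
  y = m(x + \<rho> + \<rho>^3) becomes explicit in \<open>x\<close>.
\<close>

definition form_L_shift :: "real \<Rightarrow> real \<Rightarrow> real \<Rightarrow> real \<Rightarrow> real \<Rightarrow> real" where
  "form_L_shift h m1 m2 m3 m4 = 2*m1 + h*m2 - 4*(h+1)*m3 + (4 - 2*h - h^2)*m4"
definition form_M_shift :: "real \<Rightarrow> real \<Rightarrow> real \<Rightarrow> real \<Rightarrow> real \<Rightarrow> real" where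
  "form_M_shift h m1 m2 m3 m4 = 6*m1 + 4*(h+3)*m2 - 6*(h+3)*m3 - 4*(h^2+5*h+5)*m4"
text \<open>
  By Vieta's formula this is the second root of the quadratic equation attached to m when -x is
  the first one: the product of the roots is the constant term divided by -(1 + L(m)^2).
\<close>

definition other_root :: "real \<Rightarrow> real \<Rightarrow> real \<Rightarrow> real \<Rightarrow> real \<Rightarrow> real \<Rightarrow> real" where
  "other_root h x m1 m2 m3 m4 = (34 - (form_L_shift h m1 m2 m3 m4)^2 + 2*h * form_M_shift h m1 m2 m3 m4)
      / ((1 + (form_L h m1 m2 m3 m4)^2) * x)"

lemma forms_line_multiple:
  assumes "line_multiple h r 1 m1 m2 m3 m4 y1 y2 y3 y4"
  shows "form_L h y1 y2 y3 y4 = r * form_L h m1 m2 m3 m4 + form_L_shift h m1 m2 m3 m4"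
    and "form_M y1 y2 y3 y4 = r * form_M m1 m2 m3 m4 + form_M_shift h m1 m2 m3 m4"
proof -
  have y: "y1 = r*m1 + 1*(- (h+4)*m2 + (h+4)*(h+2)*m4)" "y2 = r*m2 + 1*(m1 - (h+4)*m3)"
     "y3 = r*m3 + 1*(- (h+2)*m2 + (h^2+4*h+2)*m4)" "y4 = r*m4 + 1*(m1 - (h+2)*m3)"
    using assms by (auto simp: line_multiple_def)
  show "form_L h y1 y2 y3 y4 = r * form_L h m1 m2 m3 m4 + form_L_shift h m1 m2 m3 m4"
    unfolding form_L_def form_L_shift_def y by (simp add: algebra_simps power2_eq_square)
  show "form_M y1 y2 y3 y4 = r * form_M m1 m2 m3 m4 + form_M_shift h m1 m2 m3 m4"
    unfolding form_M_def form_M_shift_def y by (simp add: algebra_simps power2_eq_square)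
qed

lemma vieta_other_root:
  fixes K B C x :: real
  assumes "K \<noteq> 0" "x \<noteq> 0" "C - B*x - K*x^2 = 0"
  shows "C + B*(C/(K*x)) - K*(C/(K*x))^2 = 0"
proof -
  have C: "C = B*x + K*x^2" using assms(3) by simp
  have r: "C/(K*x) = B/K + x" using assms unfolding C by (simp add: field_simps power2_eq_square)
  show ?thesis unfolding r unfolding C using assms(1) by (simp add: field_simps power2_eq_square)
qed

text \<open>
  One step of the orbit.  The point is first moved to -x, with the same y; since m is the
  quotient of y by - x + \<rho> + \<rho>^3, whose relative norm equals that of x + \<rho> + \<rho>^3,
  it again has relative norm 1.  Then -x is replaced by the other root for this m.
\<close>

lemma point_step:
  assumes P: "point h x y1 y2 y3 y4" and h: "h \<ge> 2" "h \<in> \<rat>" and x: "x \<noteq> 0"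
    and m: "line_multiple h (-x) 1 m1 m2 m3 m4 y1 y2 y3 y4"
    and rat: "m1 \<in> \<rat>" "m2 \<in> \<rat>" "m3 \<in> \<rat>" "m4 \<in> \<rat>"
    and r: "r = other_root h x m1 m2 m3 m4"
    and z: "line_multiple h r 1 m1 m2 m3 m4 z1 z2 z3 z4"
  shows "point h r z1 z2 z3 z4"
proof -
  define p q where "p = h+3" and "q = h+4"
  note pq = p_def[symmetric] q_def[symmetric]
  obtain k1 k2 k3 k4 where k: "line_multiple h x 1 k1 k2 k3 k4 y1 y2 y3 y4"
    "rel_norm_const p q k1 k2 k3 k4 = 1" "rel_norm_theta p q k1 k2 k3 k4 = 0"
    using P unfolding point_def pq by blast
  define U V where "U = rel_norm_const p q x 1 0 1" and "V = rel_norm_theta p q x 1 0 1"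
  have UV': "rel_norm_const p q (-x) 1 0 1 = U" "rel_norm_theta p q (-x) 1 0 1 = V"
    by (simp_all add: U_def V_def rel_norm_const_def rel_norm_theta_def)
  define N T where "N = rel_norm_const p q m1 m2 m3 m4" and "T = rel_norm_theta p q m1 m2 m3 m4"
  have "N*U - q*T*V = U"
    using rel_norm_const_mult[OF m] rel_norm_const_mult[OF k(1)] k unfolding pq UV' N_def T_def
    by (simp add: U_def V_def)
  moreover have "N*V + T*U - p*T*V = V"
    using rel_norm_theta_mult[OF m] rel_norm_theta_mult[OF k(1)] k unfolding pq UV' N_def T_def
    by (simp add: U_def V_def)
  moreover have "U^2 - p*U*V + q*V^2 \<noteq> 0"
    using F_line_pos[OF h(1), of 1 x] unfolding pq F_form_eq_rel_norm by (simp add: U_def V_def)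
  ultimately have NT: "N = 1" "T = 0" using rel_norm_cancel by blast+
  define l1 l2 c1 c2 where "l1 = form_L h m1 m2 m3 m4" and "l2 = form_L_shift h m1 m2 m3 m4"
    and "c1 = form_M m1 m2 m3 m4" and "c2 = form_M_shift h m1 m2 m3 m4"
  define C B where "C = 34 - l2^2 + 2*h*c2" and "B = 2*h*c1 - 2*l1*l2"
  have K: "1 + l1^2 \<noteq> 0" by (metis add_eq_0_iff zero_le_power2 neg_0_le_iff_le not_one_le_zero)
  have eqn: "- (t^2) + 34 - (t*l1 + l2)^2 + 2*h*(t*c1 + c2) = C + B*t - (1+l1^2)*t^2" for t
    by (simp add: C_def B_def algebra_simps power2_eq_square)
  have "- ((-x)^2) + 34 - ((-x)*l1 + l2)^2 + 2*h*((-x)*c1 + c2) = 0"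
    using P forms_line_multiple[OF m] unfolding point_def by (simp add: l1_def l2_def c1_def c2_def)
  then have "C - B*x - (1+l1^2)*x^2 = 0" unfolding eqn by simp
  from vieta_other_root[OF K x this]
  have "C + B*r - (1+l1^2)*r^2 = 0"
    by (simp add: r other_root_def C_def l1_def l2_def c2_def)
  then have E: "- (r^2) + 34 - (form_L h z1 z2 z3 z4)^2 + 2*h * form_M z1 z2 z3 z4 = 0"
    unfolding eqn[symmetric] forms_line_multiple[OF z] by (simp add: l1_def l2_def c1_def c2_def)
  have R: "r \<in> \<rat>" unfolding r other_root_def form_L_def form_L_shift_def form_M_shift_def using rat h P
    by (auto simp: point_def)
  have Z: "z1 \<in> \<rat>" "z2 \<in> \<rat>" "z3 \<in> \<rat>" "z4 \<in> \<rat>" using z R rat h unfolding line_multiple_def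
    by auto
  show ?thesis unfolding point_def using E R Z z NT unfolding N_def T_def p_def q_def by blast
qed

section \<open>The orbit for large parameters\<close>

text \<open>
  From here on e = 1/h.  The quotient m of the orbit has coordinates of order 1, e, e and
  e^2; these and the next formulas rewrite everything in coordinates that stay bounded, so that
  only nonnegative powers of e occur.
\<close>

lemma scaled_forms:
  fixes h e :: real
  assumes he: "h * e = 1"
  shows "form_L h m1 (e*k2) (e*k3) (e^2*k4) = m1 - 2*e*k3 + 2*e^2*k4 + k2 - e*k4"
    and "form_L_shift h m1 (e*k2) (e*k3) (e^2*k4) = 2*m1 + k2 - 4*(1+e)*k3 + (4*e^2 - 2*e - 1)*k4"
    and "form_M_shift h m1 (e*k2) (e*k3) (e^2*k4)
       = 6*m1 + 4*(1+3*e)*k2 - 6*(1+3*e)*k3 - 4*(1+5*e+5*e^2)*k4"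
  unfolding form_L_def form_L_shift_def form_M_shift_def using he
  by Groebner_Basis.algebra+

lemma scaled_products:
  fixes h e :: real
  assumes he: "h * e = 1"
  shows "(h + n)*(e*k) = (1 + n*e)*k" and "(b*h)*(e*k) = b*k" and "(b*h)*(e^2*k) = b*e*k"
    and "(h^2 + 4*h + 2)*(e^2*k) = (1 + 4*e + 2*e^2)*k"
    and "(h+4)*(h+2)*(e^2*k) = (1 + 4*e)*(1 + 2*e)*k"
proof -
  show "(h + n)*(e*k) = (1 + n*e)*k"
    using arg_cong[OF he, of "\<lambda>t. t*k"] by (simp add: algebra_simps)
  show "(b*h)*(e*k) = b*k" using arg_cong[OF he, of "\<lambda>t. t*b*k"] by (simp add: algebra_simps)
  show "(b*h)*(e^2*k) = b*e*k"
    using arg_cong[OF he, of "\<lambda>t. t*b*e*k"] by (simp add: algebra_simps power2_eq_square)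
  have "(h^2 + 4*h + 2)*(e^2*k) = (h*e)^2*k + 4*(h*e)*e*k + 2*e^2*k"
    by (simp add: algebra_simps power2_eq_square)
  then show "(h^2 + 4*h + 2)*(e^2*k) = (1 + 4*e + 2*e^2)*k"
    unfolding he by (simp add: algebra_simps)
  have "(h+4)*(h+2)*(e^2*k) = (h*e)^2*k + 6*(h*e)*e*k + 8*e^2*k"
    by (simp add: algebra_simps power2_eq_square)
  then show "(h+4)*(h+2)*(e^2*k) = (1 + 4*e)*(1 + 2*e)*k"
    unfolding he by (simp add: algebra_simps power2_eq_square)
qed

text \<open>
  Division by - a + \<rho> + \<rho>^3 at a step where x1 = a stays bounded.  Here
  m = (-1 + e k1) + e k2\<rho> + e(-2 + e k3)\<rho>^2 + e^2 k4\<rho>^3, and the four linear equations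
  are solved by eliminating k1 and k2; what is left is the system \<open>P k3 + a(1+3e) k4 = R1\<close>,
  \<open>Q k3 + a S k4 = R2\<close> of determinant \<open>a D\<close>, and \<open>D\<close> tends to a^2.  Writing
  y1 - y3 = a + e z is what allows the difference of the first and third equation to be divided
  by e; otherwise k1 would drop out as e \<rightarrow> 0.
\<close>

lemma solve_even:
  fixes h e a c u v z :: real
  assumes he: "h * e = 1" and a: "a \<noteq> 0"
  defines "w \<equiv> v - u + 4" and "P \<equiv> 2*e + 4*e^2 - a^2*e^2" and "Q \<equiv> 4*e - a^2*(1+e)"
    and "S \<equiv> 2 + 4*e - a^2*e"
  defines "R1 \<equiv> a*(c - 2*a*e) + (1+2*e)*w" and "R2 \<equiv> a*(z + 2*a) + a^2*(v - 4) + 2*w"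
  defines "D \<equiv> P*S - (1+3*e)*Q"
  assumes D: "D \<noteq> 0"
  defines "k3 \<equiv> (R1*S - R2*(1+3*e)) / D" and "k4 \<equiv> (P*R2 - Q*R1) / (a*D)"
  defines "k2 \<equiv> (w - 2*e*k3 + a*e*k4) / a" and "k1 \<equiv> v - 4 + (1+2*e)*k3 + a*e*k4"
  shows "line_multiple h (-a) 1 (-1 + e*k1) (e*k2) (e*(-2 + e*k3)) (e^2*k4)
           (c + a + e*z) (1 + e*u) c (1 + e*v)"
proof -
  have k3: "D * k3 = R1*S - R2*(1+3*e)" and k4: "a * D * k4 = P*R2 - Q*R1"
    using a D by (simp_all add: k3_def k4_def)
  have "D * (P*k3 + a*(1+3*e)*k4) = P*(D*k3) + (1+3*e)*(a*D*k4)" by (simp add: algebra_simps)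
  also have "\<dots> = D * R1" unfolding k3 k4 unfolding D_def by (simp add: algebra_simps)
  finally have 1: "P*k3 + a*(1+3*e)*k4 = R1" using D by simp
  have "D * (Q*k3 + a*S*k4) = Q*(D*k3) + S*(a*D*k4)" by (simp add: algebra_simps)
  also have "\<dots> = D * R2" unfolding k3 k4 unfolding D_def by (simp add: algebra_simps)
  finally have 2: "Q*k3 + a*S*k4 = R2" using D by simp
  have k2: "a*k2 = w - 2*e*k3 + a*e*k4" using a by (simp add: k2_def)
  have k1: "k1 = v - 4 + (1+2*e)*k3 + a*e*k4" by (simp add: k1_def)
  have "a * (- a*e*(-2 + e*k3) - (1+2*e)*k2 + (1+4*e+2*e^2)*k4) = a * c"
    using 1 k2 unfolding P_def R1_def by Groebner_Basis.algebra
  then have 3: "- a*e*(-2 + e*k3) - (1+2*e)*k2 + (1+4*e+2*e^2)*k4 = c" using a by simp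
  have "a * (- a*k1 - 2*k2 + (2+6*e)*k4 + a*(-2 + e*k3)) = a * z"
    using 2 k2 k1 unfolding Q_def S_def R2_def by Groebner_Basis.algebra
  then have 4: "- a*k1 - 2*k2 + (2+6*e)*k4 + a*(-2 + e*k3) = z" using a by simp
  note sc = scaled_products[OF he]
  show ?thesis unfolding line_multiple_def
  proof (intro conjI)
    show y3: "c = - a*(e*(-2 + e*k3)) + 1*(- (h+2)*(e*k2) + (h^2+4*h+2)*(e^2*k4))"
      unfolding mult_minus_left mult_1 sc using 3 by (simp add: algebra_simps)
    show "1 + e*v = - a*(e^2*k4) + 1*(-1 + e*k1 - (h+2)*(e*(-2 + e*k3)))"
      unfolding mult_minus_left mult_1 sc k1 by (simp add: algebra_simps power2_eq_square)
    show "1 + e*u = - a*(e*k2) + 1*(-1 + e*k1 - (h+4)*(e*(-2 + e*k3)))"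
      unfolding mult_minus_left mult_1 sc k1 using arg_cong[OF k2, of "\<lambda>t. e*t"]
      by (simp add: w_def algebra_simps power2_eq_square)
    show "c + a + e*z = - a*(-1 + e*k1) + 1*(- (h+4)*(e*k2) + (h+4)*(h+2)*(e^2*k4))"
      unfolding mult_minus_left mult_1 sc using 3 arg_cong[OF 4, of "\<lambda>t. e*t"]
      by (simp add: algebra_simps power2_eq_square)
  qed
qed

text \<open>
  The same division at a step where x1 = b h has order h; now
  m = (1 + e k1) + e k2\<rho> + e^2 k3\<rho>^2 + e^2 k4\<rho>^3.
\<close>

lemma solve_odd:
  fixes h e b c f g v :: real
  assumes he: "h * e = 1" and b: "b \<noteq> 0"
  defines "t \<equiv> 1 - f + e*v" and "P \<equiv> 2*e^2 + 4*e^3 - b^2*e" and "Q \<equiv> 4*e^3 - b^2*(1+e)"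
    and "S \<equiv> 2*e + 4*e^2 - b^2"
  defines "R1 \<equiv> c*b + (1+2*e)*t" and "R2 \<equiv> b*(g - c) + b^2*v + 2*e*t"
  defines "D \<equiv> P*S - (1+3*e)*Q"
  assumes D: "D \<noteq> 0"
  defines "k3 \<equiv> (R1*S - R2*(1+3*e)) / D" and "k4 \<equiv> (P*R2 - Q*R1) / (b*D)"
  defines "k2 \<equiv> (t + b*e*k4 - 2*e^2*k3) / b" and "k1 \<equiv> v + (1+2*e)*k3 + b*k4"
  shows "line_multiple h (-(b*h)) 1 (1 + e*k1) (e*k2) (e*(e*k3)) (e^2*k4)
           (g - b*h) f c (1 + e*v)"
proof -
  have k3: "D * k3 = R1*S - R2*(1+3*e)" and k4: "b * D * k4 = P*R2 - Q*R1"
    using b D by (simp_all add: k3_def k4_def)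
  have "D * (P*k3 + b*(1+3*e)*k4) = P*(D*k3) + (1+3*e)*(b*D*k4)" by (simp add: algebra_simps)
  also have "\<dots> = D * R1" unfolding k3 k4 unfolding D_def by (simp add: algebra_simps)
  finally have 1: "P*k3 + b*(1+3*e)*k4 = R1" using D by simp
  have "D * (Q*k3 + b*S*k4) = Q*(D*k3) + S*(b*D*k4)" by (simp add: algebra_simps)
  also have "\<dots> = D * R2" unfolding k3 k4 unfolding D_def by (simp add: algebra_simps)
  finally have 2: "Q*k3 + b*S*k4 = R2" using D by simp
  have k2: "b*k2 = t + b*e*k4 - 2*e^2*k3" using b by (simp add: k2_def)
  have k1: "k1 = v + (1+2*e)*k3 + b*k4" by (simp add: k1_def)
  have "b * (- b*e*k3 - (1+2*e)*k2 + (1+4*e+2*e^2)*k4) = b * c"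
    using 1 k2 unfolding P_def R1_def by Groebner_Basis.algebra
  then have 3: "- b*e*k3 - (1+2*e)*k2 + (1+4*e+2*e^2)*k4 = c" using b by simp
  have "b * (- b*k1 - 2*e*k2 + (2+6*e)*e*k4 + b*e*k3) = b * (g - c)"
    using 2 k2 k1 unfolding Q_def S_def R2_def by Groebner_Basis.algebra
  then have 4: "- b*k1 - 2*e*k2 + (2+6*e)*e*k4 + b*e*k3 = g - c" using b by simp
  note sc = scaled_products[OF he]
  have bh: "(b*h)*(1 + e*k1) = b*h + b*k1" unfolding distrib_left sc by simp
  show ?thesis unfolding line_multiple_def
  proof (intro conjI)
    show y3: "c = - (b*h)*(e*(e*k3)) + 1*(- (h+2)*(e*k2) + (h^2+4*h+2)*(e^2*k4))"
      unfolding mult_minus_left mult_1 sc using 3 by (simp add: algebra_simps)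
    show "1 + e*v = - (b*h)*(e^2*k4) + 1*(1 + e*k1 - (h+2)*(e*(e*k3)))"
      unfolding mult_minus_left mult_1 sc k1 by (simp add: algebra_simps power2_eq_square)
    show "f = - (b*h)*(e*k2) + 1*(1 + e*k1 - (h+4)*(e*(e*k3)))"
      unfolding mult_minus_left mult_1 sc k1 using k2
      by (simp add: t_def algebra_simps power2_eq_square)
    show "g - b*h = - (b*h)*(1 + e*k1) + 1*(- (h+4)*(e*k2) + (h+4)*(h+2)*(e^2*k4))"
      unfolding mult_minus_left mult_1 sc bh using 3 4
      by (simp add: algebra_simps power2_eq_square)
  qed
qed

text \<open>
  A point depending on h = n with x1 bounded, in the coordinates that \<open>solve_even\<close> needs.  The
  deviations of y2 and y4 from 1 and of y1 from y3 + x1 are of order 1/h.  The limit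
  of the last one, 2C, makes the coefficient k1 of the quotient m tend to -2.
\<close>

definition even_family :: "real \<Rightarrow> real \<Rightarrow> bool" where
  "even_family A C \<longleftrightarrow> (\<exists>a c u v z :: nat \<Rightarrow> real. \<exists>U V.
     a \<longlonglongrightarrow> A \<and> c \<longlonglongrightarrow> C \<and> u \<longlonglongrightarrow> U \<and> v \<longlonglongrightarrow> V \<and> z \<longlonglongrightarrow> 2*C \<and>
     (\<forall>n. a n \<in> \<rat> \<and> c n \<in> \<rat> \<and> u n \<in> \<rat> \<and> v n \<in> \<rat> \<and> z n \<in> \<rat>) \<and>
     (\<forall>\<^sub>F n in sequentially. point (real n) (a n)
        (c n + a n + inverse (real n) * z n) (1 + inverse (real n) * u n)
        (c n) (1 + inverse (real n) * v n)))"

text \<open>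
  The analogue for x1 of order h.  The condition that f tends to 1 + B M ties the limit of
  y2 to the number M of the preceding step.
\<close>

definition odd_family :: "real \<Rightarrow> real \<Rightarrow> real \<Rightarrow> bool" where
  "odd_family B C M \<longleftrightarrow> (\<exists>b c f g v :: nat \<Rightarrow> real. \<exists>V.
     b \<longlonglongrightarrow> B \<and> c \<longlonglongrightarrow> C \<and> f \<longlonglongrightarrow> 1 + B*M \<and> g \<longlonglongrightarrow> C \<and> v \<longlonglongrightarrow> V \<and>
     (\<forall>n. b n \<in> \<rat> \<and> c n \<in> \<rat> \<and> f n \<in> \<rat> \<and> g n \<in> \<rat> \<and> v n \<in> \<rat>) \<and>
     (\<forall>\<^sub>F n in sequentially. point (real n) (b n * real n)
        (g n - b n * real n) (f n) (c n) (1 + inverse (real n) * v n)))"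

text \<open>
  The second root divided by h: of its numerator 34 - L^2 + 2 h M only the last term survives.
\<close>

lemma other_root_limit:
  fixes e m1 k2 k3 k4 x :: "nat \<Rightarrow> real"
  assumes e: "e = (\<lambda>n. inverse (real n))"
    and lims: "m1 \<longlonglongrightarrow> N" "k2 \<longlonglongrightarrow> M" "k3 \<longlonglongrightarrow> K3" "k4 \<longlonglongrightarrow> K4" "x \<longlonglongrightarrow> X"
    and X: "X \<noteq> 0"
  shows "(\<lambda>n. e n * other_root (real n) (x n) (m1 n) (e n * k2 n) (e n * k3 n) (e n^2 * k4 n))
     \<longlonglongrightarrow> 2 * (6*N + 4*M - 6*K3 - 4*K4) / ((1 + (N + M)^2) * X)"
proof -
  have e0: "e \<longlonglongrightarrow> 0" unfolding e by (rule lim_inverse_n)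
  define l1 where "l1 = (\<lambda>n. m1 n - 2*e n*k3 n + 2*e n^2*k4 n + k2 n - e n*k4 n)"
  define l2 where "l2 = (\<lambda>n. 2*m1 n + k2 n - 4*(1+e n)*k3 n + (4*e n^2 - 2*e n - 1)*k4 n)"
  define c2 where "c2 = (\<lambda>n. 6*m1 n + 4*(1+3*e n)*k2 n - 6*(1+3*e n)*k3 n
     - 4*(1+5*e n+5*e n^2)*k4 n)"
  have l1: "l1 \<longlonglongrightarrow> N + M" unfolding l1_def by (rule tendsto_eq_intros e0 lims refl | simp)+
  have l2: "l2 \<longlonglongrightarrow> 2*N + M - 4*K3 - K4" unfolding l2_def
    by (rule tendsto_eq_intros e0 lims refl | simp)+
  have c2: "c2 \<longlonglongrightarrow> 6*N + 4*M - 6*K3 - 4*K4" unfolding c2_def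
    by (rule tendsto_eq_intros e0 lims refl | simp)+
  have K: "(1 + (N + M)^2) * X \<noteq> 0" using X by (simp add: add_nonneg_eq_0_iff)
  have "(\<lambda>n. (34*e n - e n * (l2 n)^2 + 2*c2 n) / ((1 + (l1 n)^2) * x n))
     \<longlonglongrightarrow> (34*0 - 0 * (2*N + M - 4*K3 - K4)^2 + 2*(6*N + 4*M - 6*K3 - 4*K4)) / ((1 + (N+M)^2) * X)"
    by (intro tendsto_intros e0 l1 l2 c2 lims K)
  moreover have "\<forall>\<^sub>F n in sequentially. (34*e n - e n * (l2 n)^2 + 2*c2 n) / ((1 + (l1 n)^2) * x n)
     = e n * other_root (real n) (x n) (m1 n) (e n * k2 n) (e n * k3 n) (e n^2 * k4 n)"
    using eventually_gt_at_top[of 0]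
  proof eventually_elim
    case (elim n)
    then have he: "real n * e n = 1" by (simp add: e)
    have "e n * (34 - (l2 n)^2 + 2 * real n * c2 n) = 34*e n - e n * (l2 n)^2 + 2*(real n * e n)*c2 n"
      by (simp add: algebra_simps)
    then show ?case unfolding other_root_def scaled_forms[OF he]
      by (simp add: he l1_def l2_def c2_def)
  qed
  ultimately show ?thesis by (simp add: filterlim_cong)
qed

text \<open>
  The quotient m tends to -1 and L(m) to M - 1.  The next x1 / h tends to
  2 (6 - 4C) / ((1 + (M-1)^2) A), and 6 - 4C = 2A turns this into
  B = 4 / (1 + (M-1)^2).
\<close>

lemma even_to_odd:
  assumes ev: "even_family A C" and A: "A > 0" "A = 3 - 2*C"
  obtains B M where "B > 0" "B * (1 + (M - 1)^2) = 4" "odd_family B (C - 2*B) M"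
proof -
  from ev obtain a c u v z :: "nat \<Rightarrow> real" and U V where
    lims: "a \<longlonglongrightarrow> A" "c \<longlonglongrightarrow> C" "u \<longlonglongrightarrow> U" "v \<longlonglongrightarrow> V" "z \<longlonglongrightarrow> 2*C" and
    rat: "\<And>n. a n \<in> \<rat>" "\<And>n. c n \<in> \<rat>" "\<And>n. u n \<in> \<rat>" "\<And>n. v n \<in> \<rat>" "\<And>n. z n \<in> \<rat>" and
    pt: "\<forall>\<^sub>F n in sequentially. point (real n) (a n)
        (c n + a n + inverse (real n) * z n) (1 + inverse (real n) * u n)
        (c n) (1 + inverse (real n) * v n)"
    unfolding even_family_def by blast
  define e where "e = (\<lambda>n. inverse (real n))"
  have e0: "e \<longlonglongrightarrow> 0" unfolding e_def by (rule lim_inverse_n)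
  have re: "e n \<in> \<rat>" for n by (simp add: e_def)
  define w where "w = (\<lambda>n. v n - u n + 4)"
  define P where "P = (\<lambda>n. 2*e n + 4*e n^2 - a n^2*e n^2)"
  define Q where "Q = (\<lambda>n. 4*e n - a n^2*(1+e n))"
  define S where "S = (\<lambda>n. 2 + 4*e n - a n^2*e n)"
  define R1 where "R1 = (\<lambda>n. a n*(c n - 2*a n*e n) + (1+2*e n)*w n)"
  define R2 where "R2 = (\<lambda>n. a n*(z n + 2*a n) + a n^2*(v n - 4) + 2*w n)"
  define D where "D = (\<lambda>n. P n*S n - (1+3*e n)*Q n)"
  define k3 where "k3 = (\<lambda>n. (R1 n*S n - R2 n*(1+3*e n)) / D n)"
  define k4 where "k4 = (\<lambda>n. (P n*R2 n - Q n*R1 n) / (a n*D n))"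
  define k2 where "k2 = (\<lambda>n. (w n - 2*e n*k3 n + a n*e n*k4 n) / a n)"
  define k1 where "k1 = (\<lambda>n. v n - 4 + (1+2*e n)*k3 n + a n*e n*k4 n)"
  define W where "W = V - U + 4"
  define M where "M = W / A"
  have W: "w \<longlonglongrightarrow> W" unfolding w_def W_def by (intro tendsto_intros lims)
  have P0: "P \<longlonglongrightarrow> 0" unfolding P_def by (rule tendsto_eq_intros e0 lims refl | simp)+
  have Q0: "Q \<longlonglongrightarrow> - (A^2)" unfolding Q_def by (rule tendsto_eq_intros e0 lims refl | simp)+
  have S0: "S \<longlonglongrightarrow> 2" unfolding S_def by (rule tendsto_eq_intros e0 lims refl | simp)+
  have R10: "R1 \<longlonglongrightarrow> A*C + W" unfolding R1_def
    by (rule tendsto_eq_intros e0 lims W refl | simp)+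
  have R20: "R2 \<longlonglongrightarrow> A*(2*C + 2*A) + A^2*(V - 4) + 2*W" unfolding R2_def
    by (rule tendsto_eq_intros e0 lims W refl | simp)+
  have D0: "D \<longlonglongrightarrow> A^2" unfolding D_def
    by (rule tendsto_eq_intros e0 P0 Q0 S0 refl | simp)+
  have nz: "A \<noteq> 0" "A^2 \<noteq> 0" "A * A^2 \<noteq> 0" using A by auto
  have "k3 \<longlonglongrightarrow> ((A*C + W)*2 - (A*(2*C + 2*A) + A^2*(V - 4) + 2*W)*(1+3*0)) / A^2"
    unfolding k3_def by (intro tendsto_intros R10 S0 R20 e0 D0 nz)
  moreover have "((A*C + W)*2 - (A*(2*C + 2*A) + A^2*(V - 4) + 2*W)*(1+3*0)) / A^2 = 2 - V"
    using nz by (simp add: field_simps power2_eq_square)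
  ultimately have K3: "k3 \<longlonglongrightarrow> 2 - V" by simp
  have "k4 \<longlonglongrightarrow> (0*(A*(2*C + 2*A) + A^2*(V - 4) + 2*W) - (- (A^2))*(A*C + W)) / (A*A^2)"
    unfolding k4_def by (intro tendsto_intros P0 Q0 R10 S0 R20 e0 D0 lims nz)
  moreover have "(0*(A*(2*C + 2*A) + A^2*(V - 4) + 2*W) - (- (A^2))*(A*C + W)) / (A*A^2) = C + M"
    using nz by (simp add: M_def field_simps power2_eq_square)
  ultimately have K4: "k4 \<longlonglongrightarrow> C + M" by simp
  have "k2 \<longlonglongrightarrow> (W - 2*0*(2 - V) + A*0*(C + M)) / A"
    unfolding k2_def by (intro tendsto_intros W K3 K4 e0 lims nz)
  then have K2: "k2 \<longlonglongrightarrow> M" by (simp add: M_def)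
  have "k1 \<longlonglongrightarrow> V - 4 + (1+2*0)*(2 - V) + A*0*(C + M)"
    unfolding k1_def by (intro tendsto_intros W K3 K4 e0 lims nz)
  then have K1: "k1 \<longlonglongrightarrow> - 2" by simp
  define r where "r = (\<lambda>n. other_root (real n) (a n) (-1 + e n*k1 n) (e n*k2 n)
      (e n*(-2 + e n*k3 n)) (e n^2*k4 n))"
  define b where "b = (\<lambda>n. e n * r n)"
  define B where "B = 4 / (1 + (M - 1)^2)"
  have Mpos: "1 + (M - 1)^2 > 0" by (simp add: add_pos_nonneg)
  have Bpos: "B > 0" using Mpos by (simp add: B_def)
  have BM: "B * (1 + (M - 1)^2) = 4"
    unfolding B_def by (rule nonzero_eq_divide_eq[THEN iffD1, OF less_imp_neq[OF Mpos, symmetric] refl])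
  have "(\<lambda>n. -1 + e n*k1 n) \<longlonglongrightarrow> -1 + 0 * (-2)" "(\<lambda>n. -2 + e n*k3 n) \<longlonglongrightarrow> -2 + 0*(2 - V)"
    by (intro tendsto_intros e0 K1 K3)+
  then have m: "(\<lambda>n. -1 + e n*k1 n) \<longlonglongrightarrow> -1" "(\<lambda>n. -2 + e n*k3 n) \<longlonglongrightarrow> -2" by simp_all
  have "b \<longlonglongrightarrow> 2 * (6*(-1) + 4*M - 6*(-2) - 4*(C + M)) / ((1 + (-1 + M)^2) * A)"
    unfolding b_def r_def by (intro other_root_limit e_def m K2 K4 lims nz)
  moreover have "2 * (6*(-1) + 4*M - 6*(-2) - 4*(C + M)) / ((1 + (-1 + M)^2) * A) = B"
  proof -
    have "2 * (6*(-1) + 4*M - 6*(-2) - 4*(C + M)) = 4 * A" using A(2) by (simp add: algebra_simps)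
    moreover have "-1 + M = M - 1" by simp
    ultimately show ?thesis using nz by (simp add: B_def)
  qed
  ultimately have b: "b \<longlonglongrightarrow> B" by simp
  define c' where "c' = (\<lambda>n. b n*(-2 + e n*k3 n) - (1+2*e n)*k2 n + (1+4*e n+2*e n^2)*k4 n)"
  define f where "f = (\<lambda>n. -1 + e n*k1 n + b n*k2 n - (1+4*e n)*(-2 + e n*k3 n))"
  define g where "g = (\<lambda>n. b n*k1 n - (1+4*e n)*k2 n + (1+4*e n)*(1+2*e n)*k4 n)"
  define v' where "v' = (\<lambda>n. k1 n - (1+2*e n)*k3 n + 4 + b n*k4 n)"
  have lim: "c' \<longlonglongrightarrow> C - 2*B" "f \<longlonglongrightarrow> 1 + B*M" "g \<longlonglongrightarrow> C - 2*B"
    "v' \<longlonglongrightarrow> -2 - (2 - V) + 4 + B*(C+M)"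
    unfolding c'_def f_def g_def v'_def
    by (rule tendsto_eq_intros e0 b K1 K2 K3 K4 refl | simp)+
  have k: "k1 n \<in> \<rat>" "k2 n \<in> \<rat>" "k3 n \<in> \<rat>" "k4 n \<in> \<rat>" for n
      unfolding k1_def k2_def k3_def k4_def D_def R1_def R2_def S_def Q_def P_def w_def
      by (simp_all add: rat re)
  have rat': "b n \<in> \<rat> \<and> c' n \<in> \<rat> \<and> f n \<in> \<rat> \<and> g n \<in> \<rat> \<and> v' n \<in> \<rat>" for n
  proof -
    have bR: "b n \<in> \<rat>"
      unfolding b_def r_def other_root_def form_L_def form_L_shift_def form_M_shift_def by (simp add: rat re k)
    then show ?thesis
      unfolding c'_def f_def g_def v'_def by (simp_all add: re k bR)
  qed
  have pt': "\<forall>\<^sub>F n in sequentially. point (real n) (b n * real n)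
        (g n - b n * real n) (f n) (c' n) (1 + inverse (real n) * v' n)"
  proof -
    have "\<forall>\<^sub>F n in sequentially. a n > 0" "\<forall>\<^sub>F n in sequentially. D n > 0"
      using order_tendstoD(1)[OF lims(1)] order_tendstoD(1)[OF D0] A by auto
    then show ?thesis using pt eventually_ge_at_top[of 2]
    proof eventually_elim
      case (elim n)
      have he: "real n * e n = 1" and rn: "r n = b n * real n" using elim
        by (simp_all add: e_def b_def)
      have prod: "line_multiple (real n) (- a n) 1 (-1 + e n*k1 n) (e n*k2 n)
          (e n*(-2 + e n*k3 n)) (e n^2*k4 n)
           (c n + a n + e n*z n) (1 + e n*u n) (c n) (1 + e n*v n)"
        unfolding k1_def k2_def k3_def k4_def D_def R1_def R2_def S_def Q_def P_def w_def
        by (rule solve_even[OF he])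
          (use elim in \<open>auto simp: D_def R1_def R2_def S_def Q_def P_def w_def\<close>)
      note sc = scaled_products[OF he]
      have new: "line_multiple (real n) (r n) 1 (-1 + e n*k1 n) (e n*k2 n)
          (e n*(-2 + e n*k3 n)) (e n^2*k4 n)
          (g n - b n * real n) (f n) (c' n) (1 + e n * v' n)"
        unfolding line_multiple_def rn mult_minus_left mult_1 sc
        unfolding g_def f_def c'_def v'_def
        using he sc(2)[of "b n" "k1 n"]
        by (auto simp: algebra_simps power2_eq_square)
      have "point (real n) (r n) (g n - b n * real n) (f n) (c' n) (1 + e n * v' n)"
      proof (rule point_step[OF _ _ _ _ prod])
        show "point (real n) (a n) (c n + a n + e n*z n) (1 + e n*u n) (c n) (1 + e n*v n)"
          using elim by (simp add: e_def)
        show "r n = other_root (real n) (a n) (-1 + e n*k1 n) (e n*k2 n)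
           (e n*(-2 + e n*k3 n)) (e n^2*k4 n)" by (simp add: r_def)
        show "line_multiple (real n) (r n) 1 (-1 + e n*k1 n) (e n*k2 n)
          (e n*(-2 + e n*k3 n)) (e n^2*k4 n)
          (g n - b n * real n) (f n) (c' n) (1 + e n * v' n)" by (rule new)
      qed (use elim in \<open>auto simp: re k\<close>)
      then show ?case by (simp add: rn e_def)
    qed
  qed
  have "odd_family B (C - 2*B) M" unfolding odd_family_def
    by (rule exI[of _ b], rule exI[of _ c'], rule exI[of _ f], rule exI[of _ g], rule exI[of _ v'])
      (use b lim rat' pt' in blast)
  then show ?thesis by (rule that[OF Bpos BM])
qed

text \<open>
  Now m tends to 1 and L(m) to 1 - M, so that the same number 1 + (M-1)^2 occurs and cancels
  against B: the next x1 tends to 3 - 2C.  Together with the shift of C by - 2B in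
  \<open>even_to_odd\<close>, the limit 3 - 2C of x1 grows by 4B > 0 over two steps.
\<close>

lemma odd_to_even:
  assumes od: "odd_family B C M" and B: "B > 0" "B * (1 + (M - 1)^2) = 4"
  shows "even_family (3 - 2*C) C"
proof -
  from od obtain b c f g v :: "nat \<Rightarrow> real" and V where
    lims: "b \<longlonglongrightarrow> B" "c \<longlonglongrightarrow> C" "f \<longlonglongrightarrow> 1 + B*M" "g \<longlonglongrightarrow> C" "v \<longlonglongrightarrow> V" and
    rat: "\<And>n. b n \<in> \<rat>" "\<And>n. c n \<in> \<rat>" "\<And>n. f n \<in> \<rat>" "\<And>n. g n \<in> \<rat>" "\<And>n. v n \<in> \<rat>" and
    pt: "\<forall>\<^sub>F n in sequentially. point (real n) (b n * real n)
        (g n - b n * real n) (f n) (c n) (1 + inverse (real n) * v n)"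
    unfolding odd_family_def by blast
  define e where "e = (\<lambda>n. inverse (real n))"
  have e0: "e \<longlonglongrightarrow> 0" unfolding e_def by (rule lim_inverse_n)
  have re: "e n \<in> \<rat>" for n by (simp add: e_def)
  define t where "t = (\<lambda>n. 1 - f n + e n*v n)"
  define P where "P = (\<lambda>n. 2*e n^2 + 4*e n^3 - b n^2*e n)"
  define Q where "Q = (\<lambda>n. 4*e n^3 - b n^2*(1+e n))"
  define S where "S = (\<lambda>n. 2*e n + 4*e n^2 - b n^2)"
  define R1 where "R1 = (\<lambda>n. c n*b n + (1+2*e n)*t n)"
  define R2 where "R2 = (\<lambda>n. b n*(g n - c n) + b n^2*v n + 2*e n*t n)"
  define D where "D = (\<lambda>n. P n*S n - (1+3*e n)*Q n)"
  define k3 where "k3 = (\<lambda>n. (R1 n*S n - R2 n*(1+3*e n)) / D n)"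
  define k4 where "k4 = (\<lambda>n. (P n*R2 n - Q n*R1 n) / (b n*D n))"
  define k2 where "k2 = (\<lambda>n. (t n + b n*e n*k4 n - 2*e n^2*k3 n) / b n)"
  define k1 where "k1 = (\<lambda>n. v n + (1+2*e n)*k3 n + b n*k4 n)"
  have t: "t \<longlonglongrightarrow> - (B*M)" unfolding t_def by (rule tendsto_eq_intros e0 lims refl | simp)+
  have P0: "P \<longlonglongrightarrow> 0" unfolding P_def by (rule tendsto_eq_intros e0 lims refl | simp)+
  have Q0: "Q \<longlonglongrightarrow> - (B^2)" unfolding Q_def by (rule tendsto_eq_intros e0 lims refl | simp)+
  have S0: "S \<longlonglongrightarrow> - (B^2)" unfolding S_def by (rule tendsto_eq_intros e0 lims refl | simp)+
  have R10: "R1 \<longlonglongrightarrow> C*B - B*M" unfolding R1_def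
    by (rule tendsto_eq_intros e0 lims t refl | simp)+
  have R20: "R2 \<longlonglongrightarrow> B^2*V" unfolding R2_def
    by (rule tendsto_eq_intros e0 lims t refl | simp)+
  have D0: "D \<longlonglongrightarrow> B^2" unfolding D_def
    by (rule tendsto_eq_intros e0 P0 Q0 S0 refl | simp)+
  have nz: "B \<noteq> 0" "B^2 \<noteq> 0" "B * B^2 \<noteq> 0" using B by auto
  have "k3 \<longlonglongrightarrow> ((C*B - B*M)*(- (B^2)) - B^2*V*(1+3*0)) / B^2"
    unfolding k3_def by (intro tendsto_intros R10 S0 R20 e0 D0 nz)
  moreover have "((C*B - B*M)*(- (B^2)) - B^2*V*(1+3*0)) / B^2 = B*(M - C) - V"
    using nz by (simp add: field_simps power2_eq_square)
  ultimately have K3: "k3 \<longlonglongrightarrow> B*(M - C) - V" by simp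
  have "k4 \<longlonglongrightarrow> (0*(B^2*V) - (- (B^2))*(C*B - B*M)) / (B*B^2)"
    unfolding k4_def by (intro tendsto_intros P0 Q0 R10 S0 R20 e0 D0 lims nz)
  moreover have "(0*(B^2*V) - (- (B^2))*(C*B - B*M)) / (B*B^2) = C - M"
    using nz by (simp add: field_simps power2_eq_square)
  ultimately have K4: "k4 \<longlonglongrightarrow> C - M" by simp
  have "k2 \<longlonglongrightarrow> (- (B*M) + B*0*(C - M) - 2*0^2*(B*(M - C) - V)) / B"
    unfolding k2_def by (intro tendsto_intros t K3 K4 e0 lims nz)
  then have K2: "k2 \<longlonglongrightarrow> - M" using nz by simp
  have "k1 \<longlonglongrightarrow> V + (1+2*0)*(B*(M - C) - V) + B*(C - M)"
    unfolding k1_def by (intro tendsto_intros K3 K4 e0 lims nz)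
  moreover have "V + (1+2*0)*(B*(M - C) - V) + B*(C - M) = 0" by (simp add: algebra_simps)
  ultimately have K1: "k1 \<longlonglongrightarrow> 0" by simp
  define a where "a = (\<lambda>n. other_root (real n) (b n * real n) (1 + e n*k1 n) (e n*k2 n)
      (e n*(e n*k3 n)) (e n^2*k4 n))"
  have "(\<lambda>n. 1 + e n*k1 n) \<longlonglongrightarrow> 1 + 0 * 0" "(\<lambda>n. e n*k3 n) \<longlonglongrightarrow> 0*(B*(M - C) - V)"
    by (intro tendsto_intros e0 K1 K3)+
  then have m: "(\<lambda>n. 1 + e n*k1 n) \<longlonglongrightarrow> 1" "(\<lambda>n. e n*k3 n) \<longlonglongrightarrow> 0" by simp_all
  have "(\<lambda>n. e n * other_root (real n) (b n) (1 + e n*k1 n) (e n*k2 n) (e n*(e n*k3 n)) (e n^2*k4 n))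
      \<longlonglongrightarrow> 2 * (6*1 + 4*(-M) - 6*0 - 4*(C - M)) / ((1 + (1 + - M)^2) * B)"
    by (intro other_root_limit e_def m K2 K4 lims nz)
  moreover have "2 * (6*1 + 4*(-M) - 6*0 - 4*(C - M)) / ((1 + (1 + - M)^2) * B) = 3 - 2*C"
  proof -
    have "(1 + (1 + - M)^2) * B = 4" using B(2) by (simp add: algebra_simps power2_eq_square)
    then show ?thesis by (simp add: field_simps)
  qed
  moreover have "(\<lambda>n. e n * other_root (real n) (b n) (1 + e n*k1 n) (e n*k2 n)
       (e n*(e n*k3 n)) (e n^2*k4 n)) = a"
    by (simp add: a_def e_def other_root_def fun_eq_iff divide_inverse mult_ac)
  ultimately have a: "a \<longlonglongrightarrow> 3 - 2*C" by simp
  define c' where "c' = (\<lambda>n. a n*(e n^2*k3 n) - (1+2*e n)*k2 n + (1+4*e n+2*e n^2)*k4 n)"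
  define z where "z = (\<lambda>n. a n*k1 n - 2*k2 n + (2+6*e n)*k4 n - a n*(e n*k3 n))"
  define u where "u = (\<lambda>n. k1 n + a n*k2 n - (1+4*e n)*k3 n)"
  define v' where "v' = (\<lambda>n. k1 n - (1+2*e n)*k3 n + a n*(e n*k4 n))"
  have lim: "c' \<longlonglongrightarrow> C" "z \<longlonglongrightarrow> 2*C" "u \<longlonglongrightarrow> (3 - 2*C)*(- M) - (B*(M - C) - V)"
    "v' \<longlonglongrightarrow> - (B*(M - C) - V)"
    unfolding c'_def z_def u_def v'_def
    by (rule tendsto_eq_intros e0 a K1 K2 K3 K4 refl | simp)+
  have k: "k1 n \<in> \<rat>" "k2 n \<in> \<rat>" "k3 n \<in> \<rat>" "k4 n \<in> \<rat>" for n
      unfolding k1_def k2_def k3_def k4_def D_def R1_def R2_def S_def Q_def P_def t_def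
      by (simp_all add: rat re)
  have rat': "a n \<in> \<rat> \<and> c' n \<in> \<rat> \<and> u n \<in> \<rat> \<and> v' n \<in> \<rat> \<and> z n \<in> \<rat>" for n
  proof -
    have aR: "a n \<in> \<rat>"
      unfolding a_def other_root_def form_L_def form_L_shift_def form_M_shift_def by (simp add: rat re k)
    then show ?thesis
      unfolding c'_def z_def u_def v'_def by (simp_all add: re k aR)
  qed
  have pt': "\<forall>\<^sub>F n in sequentially. point (real n) (a n)
        (c' n + a n + inverse (real n) * z n) (1 + inverse (real n) * u n)
        (c' n) (1 + inverse (real n) * v' n)"
  proof -
    have "\<forall>\<^sub>F n in sequentially. b n > 0" "\<forall>\<^sub>F n in sequentially. D n > 0"
      using order_tendstoD(1)[OF lims(1)] order_tendstoD(1)[OF D0] B by auto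
    then show ?thesis using pt eventually_ge_at_top[of 2]
    proof eventually_elim
      case (elim n)
      have he: "real n * e n = 1" using elim by (simp add: e_def)
      have prod: "line_multiple (real n) (- (b n * real n)) 1 (1 + e n*k1 n) (e n*k2 n)
          (e n*(e n*k3 n)) (e n^2*k4 n)
           (g n - b n * real n) (f n) (c n) (1 + e n*v n)"
        unfolding k1_def k2_def k3_def k4_def D_def R1_def R2_def S_def Q_def P_def t_def
        by (rule solve_odd[OF he])
          (use elim in \<open>auto simp: D_def R1_def R2_def S_def Q_def P_def t_def\<close>)
      note sc = scaled_products[OF he]
      have new: "line_multiple (real n) (a n) 1 (1 + e n*k1 n) (e n*k2 n)
          (e n*(e n*k3 n)) (e n^2*k4 n)
          (c' n + a n + e n * z n) (1 + e n * u n) (c' n) (1 + e n * v' n)"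
        unfolding line_multiple_def mult_minus_left mult_1 sc
        unfolding u_def z_def c'_def v'_def
        by (simp add: algebra_simps power2_eq_square)
      have "point (real n) (a n) (c' n + a n + e n * z n) (1 + e n * u n) (c' n) (1 + e n * v' n)"
      proof (rule point_step[OF _ _ _ _ prod])
        show "point (real n) (b n * real n) (g n - b n * real n) (f n) (c n) (1 + e n*v n)"
          using elim by (simp add: e_def)
        show "a n = other_root (real n) (b n * real n) (1 + e n*k1 n) (e n*k2 n)
           (e n*(e n*k3 n)) (e n^2*k4 n)" by (simp add: a_def)
        show "line_multiple (real n) (a n) 1 (1 + e n*k1 n) (e n*k2 n)
          (e n*(e n*k3 n)) (e n^2*k4 n)
          (c' n + a n + e n * z n) (1 + e n * u n) (c' n) (1 + e n * v' n)" by (rule new)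
      qed (use elim in \<open>auto simp: re k\<close>)
      then show ?case by (simp add: e_def)
    qed
  qed
  show ?thesis unfolding even_family_def
    by (rule exI[of _ a], rule exI[of _ c'], rule exI[of _ u], rule exI[of _ v'], rule exI[of _ z])
      (use a lim rat' pt' in blast)
qed

text \<open>The solution \<alpha> = y = 3 + \<rho> + \<rho>^3, with m = 1, exists for every h.\<close>

lemma even_family_start: "even_family 3 0"
proof -
  have "point (real n) 3 3 1 0 1" for n
  proof -
    have "line_multiple (real n) 3 1 1 0 0 0 3 1 0 1"
      "rel_norm_const (real n + 3) (real n + 4) 1 0 0 0 = 1" "rel_norm_theta (real n + 3) (real n + 4) 1 0 0 0 = 0"
      by (simp_all add: line_multiple_def rel_norm_const_def rel_norm_theta_def)
    then show ?thesis unfolding point_def by (auto simp: form_L_def form_M_def)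
  qed
  then have "(\<lambda>n::nat. 3) \<longlonglongrightarrow> (3::real)" "(\<lambda>n::nat. 0) \<longlonglongrightarrow> (0::real)" 
    "\<forall>\<^sub>F n in sequentially. point (real n) ((\<lambda>n. 3) n)
        ((\<lambda>n. 0) n + (\<lambda>n. 3) n + inverse (real n) * (\<lambda>n. 0) n) (1 + inverse (real n) * (\<lambda>n. 0) n)
        ((\<lambda>n. 0) n) (1 + inverse (real n) * (\<lambda>n. 0) n)" by simp_all
  then show ?thesis unfolding even_family_def
    by (intro exI[of _ "\<lambda>n. 3"] exI[of _ "\<lambda>n. 0"] exI[of _ 0]) simp
qed

text \<open>A finite set of limits would have a largest element A, but A + 4B is again a limit.\<close>

lemma even_family_infinite: "infinite {A. A > 0 \<and> even_family A ((3 - A)/2)}"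
proof
  let ?S = "{A. A > 0 \<and> even_family A ((3 - A)/2)}"
  assume fin: "finite ?S"
  have "3 \<in> ?S" using even_family_start by simp
  then have ne: "?S \<noteq> {}" by blast
  define A where "A = Max ?S"
  have A: "A > 0" "even_family A ((3 - A)/2)" using Max_in[OF fin ne] by (auto simp: A_def)
  obtain B M where B: "B > 0" "B * (1 + (M - 1)^2) = 4" "odd_family B ((3 - A)/2 - 2*B) M"
    by (rule even_to_odd[OF A(2,1)]) (auto simp: field_simps)
  have "even_family (3 - 2*((3 - A)/2 - 2*B)) ((3 - A)/2 - 2*B)"
    by (rule odd_to_even[OF B(3,1,2)])
  moreover have "3 - 2*((3 - A)/2 - 2*B) = A + 4*B" "(3 - A)/2 - 2*B = (3 - (A + 4*B))/2"
    by (simp_all add: field_simps)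
  ultimately have "even_family (A + 4*B) ((3 - (A + 4*B))/2)" by simp
  then have "A + 4*B \<in> ?S" using A B by simp
  then have "A + 4*B \<le> A" unfolding A_def using fin by (rule Max_ge[rotated])
  then show False using B by simp
qed

section \<open>From rational points to integer solutions\<close>

lemma common_denominator:
  assumes "finite S" "S \<subseteq> \<rat>"
  shows "\<exists>d::int. d > 0 \<and> (\<forall>x\<in>S. real_of_int d * x \<in> \<int>)"
  using assms
proof (induction S rule: finite_induct)
  case empty
  show ?case by (rule exI[of _ 1]) simp
next
  case (insert y S)
  then obtain d :: int where d: "d > 0" "\<forall>x\<in>S. real_of_int d * x \<in> \<int>" by auto
  have "y \<in> \<rat>" using insert.prems by simp
  then obtain a b :: int where ab: "b > 0" "y = of_int a / of_int b"
    by (elim Rats_cases') blast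
  have "real_of_int (d*b) * x \<in> \<int>" if "x \<in> insert y S" for x
  proof (cases "x = y")
    case True
    then have "real_of_int (d*b) * x = of_int (d*a)" using ab by simp
    then show ?thesis by (simp only: Ints_of_int)
  next
    case False
    then have "real_of_int d * x \<in> \<int>" using d that by simp
    then have "of_int b * (real_of_int d * x) \<in> \<int>" by (rule Ints_mult[OF Ints_of_int])
    then show ?thesis by (simp add: mult_ac)
  qed
  then show ?case using d ab by (intro exI[of _ "d*b"]) auto
qed

lemma line_multiple_scale:
  fixes h :: real
  assumes "line_multiple h x1 x2 m1 m2 m3 m4 y1 y2 y3 y4"
  shows "line_multiple h (d*x1) (d*x2) m1 m2 m3 m4 (d*y1) (d*y2) (d*y3) (d*y4)"
    and "line_multiple h x1 x2 (d*m1) (d*m2) (d*m3) (d*m4) (d*y1) (d*y2) (d*y3) (d*y4)"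
proof -
  have y: "y1 = x1*m1 + x2*(- (h+4)*m2 + (h+4)*(h+2)*m4)" "y2 = x1*m2 + x2*(m1 - (h+4)*m3)"
     "y3 = x1*m3 + x2*(- (h+2)*m2 + (h^2+4*h+2)*m4)" "y4 = x1*m4 + x2*(m1 - (h+2)*m3)"
    using assms by (auto simp: line_multiple_def)
  show "line_multiple h (d*x1) (d*x2) m1 m2 m3 m4 (d*y1) (d*y2) (d*y3) (d*y4)"
    "line_multiple h x1 x2 (d*m1) (d*m2) (d*m3) (d*m4) (d*y1) (d*y2) (d*y3) (d*y4)"
    unfolding line_multiple_def y by (simp_all add: algebra_simps)
qed

lemma A_mat_line_multiple:
  "vec_of_list [y1, y2, y3, y4] = A_mat (h+3) (h+4) x1 x2 0 x2 *\<^sub>v vec_of_list [m1, m2, m3, m4]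
     \<longleftrightarrow> line_multiple h x1 x2 m1 m2 m3 m4 y1 y2 y3 y4"
proof -
  have "y1 = m1*x1 - (h+4)*m4*x2 - (h+4)*m3*0 - (h+4)*(m2 - (h+3)*m4)*x2 \<longleftrightarrow>
      y1 = x1*m1 + x2*(- (h+4)*m2 + (h+4)*(h+2)*m4)" by (simp add: algebra_simps)
  moreover have "y2 = m2*x1 + m1*x2 - (h+4)*m4*0 - (h+4)*m3*x2 \<longleftrightarrow>
      y2 = x1*m2 + x2*(m1 - (h+4)*m3)" by (simp add: algebra_simps)
  moreover have "y3 = m3*x1 + (m2 - (h+3)*m4)*x2 + (m1 - (h+3)*m3)*0 - ((h+3)*m2 - ((h+3)^2 - (h+4))*m4)*x2
      \<longleftrightarrow> y3 = x1*m3 + x2*(- (h+2)*m2 + (h^2+4*h+2)*m4)"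
    by (simp add: algebra_simps power2_eq_square)
  moreover have "y4 = m4*x1 + m3*x2 + (m2 - (h+3)*m4)*0 + (m1 - (h+3)*m3)*x2
      \<longleftrightarrow> y4 = x1*m4 + x2*(m1 - (h+2)*m3)" by (simp add: algebra_simps)
  moreover have "vec_of_list l = vec_of_list l' \<longleftrightarrow> l = l'" for l l' :: "'a list"
    by (metis list_vec)
  ultimately show ?thesis unfolding A_mat_mult_vec line_multiple_def by simp
qed

text \<open>
  This is A \<cdot> adj(A) = F.  It will be used over the integers and then read over the
  reals, where it identifies the integers Gj with F mj for the real vector m.
\<close>

lemma G_vec_line_multiple:
  fixes h :: "'a::comm_ring_1"
  defines "p \<equiv> h+3" and "q \<equiv> h+4"
  assumes g: "g = G_vec p q x1 x2 0 x2 y1 y2 y3 y4"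
  defines "F \<equiv> F_form p q x1 x2 0 x2"
  shows "line_multiple h x1 x2 (g$0) (g$1) (g$2) (g$3) (F*y1) (F*y2) (F*y3) (F*y4)"
proof -
  let ?A = "A_mat p q x1 x2 0 x2" and ?y = "vec_of_list [y1, y2, y3, y4]"
  have y: "?y \<in> carrier_vec 4" by (rule carrier_vecI) simp
  have "dim_vec g = 4" using adj_mat(1)[OF A_mat_carrier, of p q x1 x2 0 x2]
    by (simp add: g G_vec_def)
  then have gl: "vec_of_list [g$0, g$1, g$2, g$3] = g"
    by (intro eq_vecI) (auto simp: vec_of_list_index less_Suc_eq numeral_eq_Suc nth_Cons' )
  have "?A *\<^sub>v g = (?A * adj_mat ?A) *\<^sub>v ?y"
    unfolding g G_vec_def
    using assoc_mult_mat_vec[OF A_mat_carrier adj_mat(1)[OF A_mat_carrier] y] by simp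
  also have "\<dots> = (F \<cdot>\<^sub>m 1\<^sub>m 4) *\<^sub>v ?y"
    by (simp only: adj_mat(2)[OF A_mat_carrier] det_A_mat F_def)
  also have "\<dots> = F \<cdot>\<^sub>v ?y"
    by (rule eq_vecI) (use y in auto)
  also have "\<dots> = vec_of_list [F*y1, F*y2, F*y3, F*y4]"
    by (rule eq_vecI) (auto simp: vec_of_list_index less_Suc_eq numeral_eq_Suc)
  finally have "vec_of_list [F*y1, F*y2, F*y3, F*y4] = ?A *\<^sub>v vec_of_list [g$0, g$1, g$2, g$3]"
    unfolding gl by (rule sym)
  then show ?thesis unfolding p_def q_def A_mat_line_multiple .
qed

lemma line_multiple_cancel:
  fixes h :: real
  assumes F: "F_form (h+3) (h+4) x1 x2 0 x2 \<noteq> 0"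
    and "line_multiple h x1 x2 m1 m2 m3 m4 y1 y2 y3 y4" "line_multiple h x1 x2 k1 k2 k3 k4 y1 y2 y3 y4"
  shows "m1 = k1 \<and> m2 = k2 \<and> m3 = k3 \<and> m4 = k4"
proof -
  have "F_form (h+3) (h+4) x1 x2 0 x2 \<cdot>\<^sub>v vec_of_list [m1,m2,m3,m4]
      = F_form (h+3) (h+4) x1 x2 0 x2 \<cdot>\<^sub>v vec_of_list [k1,k2,k3,k4]"
    using assms(2,3) unfolding A_mat_line_multiple[symmetric] by (metis G_vec_identity)
  then have *: "(F_form (h+3) (h+4) x1 x2 0 x2 \<cdot>\<^sub>v vec_of_list [m1,m2,m3,m4]) $ i
      = (F_form (h+3) (h+4) x1 x2 0 x2 \<cdot>\<^sub>v vec_of_list [k1,k2,k3,k4]) $ i" for i by simp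
  show ?thesis using *[of 0] *[of 1] *[of 2] *[of 3] F
    by (simp add: vec_of_list_index numeral_2_eq_2 numeral_3_eq_3)
qed

lemma line_multiple_of_int:
  "line_multiple h x1 x2 m1 m2 m3 m4 y1 y2 y3 y4 \<Longrightarrow> line_multiple (real_of_int h) (of_int x1) (of_int x2)
     (of_int m1) (of_int m2) (of_int m3) (of_int m4) (of_int y1) (of_int y2) (of_int y3) (of_int y4)"
  unfolding line_multiple_def by simp

lemma F_form_of_int:
  "real_of_int (F_form p q a b c d)
     = F_form (of_int p) (of_int q) (of_int a) (of_int b) (of_int c) (of_int d)"
  by (simp add: F_form_def)

text \<open>
  Both equations are homogeneous, so a common denominator \<open>D\<close> of the coordinates can be multiplied in.
  It does not affect the quotient m, whose coordinates are in general not integers; this is why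
  Gj = mj F is established over the reals.
\<close>

lemma integer_solution:
  fixes h D X Y1 Y2 Y3 Y4 :: int
  assumes h: "h \<ge> 2" and D: "D > 0"
    and pt: "point (of_int h) x y1 y2 y3 y4"
    and int: "of_int X = of_int D * x" "of_int Y1 = of_int D * y1" "of_int Y2 = of_int D * y2"
      "of_int Y3 = of_int D * y3" "of_int Y4 = of_int D * y4"
  shows "F_form (h+3) (h+4) X D 0 D = F_form (h+3) (h+4) Y1 Y2 Y3 Y4"
    and "sextic_lhs h X D 0 D Y1 Y2 Y3 Y4 = 0"
proof -
  define p q where "p = real_of_int h + 3" and "q = real_of_int h + 4"
  obtain m1 m2 m3 m4 where m: "line_multiple (of_int h) x 1 m1 m2 m3 m4 y1 y2 y3 y4"
    "rel_norm_const p q m1 m2 m3 m4 = 1" "rel_norm_theta p q m1 m2 m3 m4 = 0"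
    and eqn: "- (x^2) + 34 - (form_L h y1 y2 y3 y4)^2 + 2 * of_int h * form_M y1 y2 y3 y4 = 0"
    using pt unfolding point_def p_def q_def by blast
  have M: "line_multiple (of_int h) (of_int X) (of_int D) m1 m2 m3 m4
      (of_int Y1) (of_int Y2) (of_int Y3) (of_int Y4)"
    using line_multiple_scale(1)[OF m(1), of "of_int D"] by (simp add: int)
  define F where "F = F_form p q (of_int X) (of_int D) 0 (of_int D)"
  have F0: "F \<noteq> 0" using F_line_pos[of "of_int h" "of_int D" "of_int X"] h D
    by (simp add: F_def p_def q_def)
  have "F_form p q (of_int Y1) (of_int Y2) (of_int Y3) (of_int Y4) = F"
    using rel_norm_const_mult[OF M] rel_norm_theta_mult[OF M] m(2,3) unfolding F_form_eq_rel_norm F_def p_def q_def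
    by simp
  then have "real_of_int (F_form (h+3) (h+4) X D 0 D) = real_of_int (F_form (h+3) (h+4) Y1 Y2 Y3 Y4)"
    unfolding F_form_of_int F_def p_def q_def by simp
  then show "F_form (h+3) (h+4) X D 0 D = F_form (h+3) (h+4) Y1 Y2 Y3 Y4"
    unfolding of_int_eq_iff .
  define g where "g = G_vec (h+3) (h+4) X D 0 D Y1 Y2 Y3 Y4"
  have Fi: "real_of_int (F_form (h+3) (h+4) X D 0 D) = F"
    unfolding F_form_of_int F_def p_def q_def by simp
  have g: "real_of_int (g$0) = F*m1 \<and> real_of_int (g$1) = F*m2 \<and>
     real_of_int (g$2) = F*m3 \<and> real_of_int (g$3) = F*m4"
  proof (rule line_multiple_cancel)
    show "F_form (of_int h + 3) (of_int h + 4) (of_int X) (of_int D) 0 (of_int D) \<noteq> (0::real)"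
      using F0 by (simp add: F_def p_def q_def)
    show "line_multiple (of_int h) (of_int X) (of_int D) (of_int (g$0)) (of_int (g$1)) (of_int (g$2))
      (of_int (g$3)) (F * of_int Y1) (F * of_int Y2) (F * of_int Y3) (F * of_int Y4)"
      using line_multiple_of_int[OF G_vec_line_multiple[OF g_def]] by (simp add: Fi)
    show "line_multiple (of_int h) (of_int X) (of_int D) (F*m1) (F*m2) (F*m3) (F*m4)
      (F * of_int Y1) (F * of_int Y2) (F * of_int Y3) (F * of_int Y4)"
      by (rule line_multiple_scale(2)[OF M])
  qed
  define c1 c2 c3 where "c1 = - 2*Y1*Y2 + 3*Y2^2 + 2*(h+3)*Y2*Y3 - 3*(h+3)*Y2*Y4 - 2*(h+4)*Y3*Y4 + 3*(h+4)*Y4^2"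
    and "c2 = 2*Y1^2 - 3*Y1*Y2 - 2*(h+3)*Y1*Y3 + 3*(h+3)*Y1*Y4 + 2*(h+4)*Y3^2 - 3*(h+4)*Y3*Y4"
    and "c3 = Y1*Y4 - Y2*Y3"
  have Hg: "H_form (h+3) (h+4) X D 0 D Y1 Y2 Y3 Y4
     = c1 * g$0 + c2 * g$1 + 2*(h+4)*c3*g$2 - 3*(h+4)*c3*g$3"
    unfolding H_form_def Let_def g_def c1_def c2_def c3_def ..
  have "real_of_int (H_form (h+3) (h+4) X D 0 D Y1 Y2 Y3 Y4)
     = of_int c1 * of_int (g$0) + of_int c2 * of_int (g$1) + 2*q*of_int c3 * of_int (g$2)
       - 3*q*of_int c3 * of_int (g$3)"
    unfolding Hg q_def by simp
  also have "\<dots> = F * (of_int c1 * m1 + of_int c2 * m2 + 2*q*of_int c3*m3 - 3*q*of_int c3*m4)"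
    unfolding g[THEN conjunct1] g[THEN conjunct2, THEN conjunct1]
      g[THEN conjunct2, THEN conjunct2, THEN conjunct1] g[THEN conjunct2, THEN conjunct2, THEN conjunct2]
    by (simp add: algebra_simps)
  also have "of_int c1 * m1 + of_int c2 * m2 + 2*q*of_int c3*m3 - 3*q*of_int c3*m4
     = of_int D * form_M (of_int Y1) (of_int Y2) (of_int Y3) (of_int Y4)"
    using H_form_reduce[OF M] m(2,3) unfolding c1_def c2_def c3_def p_def q_def by simp
  finally have H: "real_of_int (H_form (h+3) (h+4) X D 0 D Y1 Y2 Y3 Y4)
     = F * (of_int D * form_M (of_int Y1) (of_int Y2) (of_int Y3) (of_int Y4))" .
  have "real_of_int (sextic_lhs h X D 0 D Y1 Y2 Y3 Y4)
     = F * (- (of_int X^2) + 3*of_int D^2 + 31*of_int D^2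
         - (form_L h (of_int Y1) (of_int Y2) (of_int Y3) (of_int Y4))^2)
       + 2 * of_int h * real_of_int (H_form (h+3) (h+4) X D 0 D Y1 Y2 Y3 Y4)"
    unfolding sextic_lhs_def by (simp add: Fi form_L_def)
  also have "\<dots> = F * of_int D^2 *
      (- (x^2) + 34 - (form_L h y1 y2 y3 y4)^2 + 2 * of_int h * form_M y1 y2 y3 y4)"
    unfolding H int form_L_def form_M_def by (simp add: algebra_simps power2_eq_square)
  finally have "real_of_int (sextic_lhs h X D 0 D Y1 Y2 Y3 Y4) = 0" unfolding eqn by simp
  then show "sextic_lhs h X D 0 D Y1 Y2 Y3 Y4 = 0" by simp
qed

lemma even_family_solution_family:
  assumes "even_family A C"
  shows "\<exists>a y1 y2 y3 y4 :: nat \<Rightarrow> real. a \<longlonglongrightarrow> A \<and>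
     (\<forall>\<^sub>F n in sequentially. point (real n) (a n) (y1 n) (y2 n) (y3 n) (y4 n))"
proof -
  from assms obtain a c u v z :: "nat \<Rightarrow> real" where "a \<longlonglongrightarrow> A"
    "\<forall>\<^sub>F n in sequentially. point (real n) (a n)
        (c n + a n + inverse (real n) * z n) (1 + inverse (real n) * u n)
        (c n) (1 + inverse (real n) * v n)"
    unfolding even_family_def by blast
  then show ?thesis
    by (intro exI[of _ a] exI[of _ "\<lambda>n. c n + a n + inverse (real n) * z n"]
        exI[of _ "\<lambda>n. 1 + inverse (real n) * u n"] exI[of _ c]
        exI[of _ "\<lambda>n. 1 + inverse (real n) * v n"]) simp
qed

text \<open>The ratios x1 : x2 of integer solutions; they tell solutions apart up to a factor.\<close>

definition solution_ratio :: "int \<Rightarrow> real \<Rightarrow> bool" where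
  "solution_ratio h x \<longleftrightarrow> (\<exists>D X Y1 Y2 Y3 Y4. D > 0 \<and> of_int X = of_int D * x \<and>
     F_form (h+3) (h+4) X D 0 D = F_form (h+3) (h+4) Y1 Y2 Y3 Y4 \<and>
     sextic_lhs h X D 0 D Y1 Y2 Y3 Y4 = 0)"

lemma point_solution_ratio:
  assumes "h \<ge> 2" "point (real_of_int h) x y1 y2 y3 y4"
  shows "solution_ratio h x"
proof -
  obtain d :: int where d: "d > 0" "\<forall>t\<in>{x,y1,y2,y3,y4}. real_of_int d * t \<in> \<int>"
    using common_denominator[of "{x,y1,y2,y3,y4}"] assms(2) by (auto simp: point_def)
  then obtain X Y1 Y2 Y3 Y4 where i: "of_int X = of_int d * x" "of_int Y1 = of_int d * y1"
    "of_int Y2 = of_int d * y2" "of_int Y3 = of_int d * y3" "of_int Y4 = of_int d * y4"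
    by (auto elim!: Ints_cases)
  show ?thesis unfolding solution_ratio_def
    using integer_solution[OF assms(1) d(1) assms(2) i] d(1) i(1) by blast
qed

lemma many_solution_ratios:
  "\<forall>\<^sub>F n in sequentially. \<exists>R. card R = k \<and> finite R \<and> (\<forall>x\<in>R. solution_ratio (int n) x)"
proof -
  obtain T where T: "finite T" "card T = k" "\<forall>A\<in>T. even_family A ((3 - A)/2)"
    using infinite_arbitrarily_large[OF even_family_infinite, of k] by blast
  have "\<forall>A\<in>T. \<exists>a. a \<longlonglongrightarrow> A \<and> (\<forall>\<^sub>F n in sequentially. solution_ratio (int n) (a n))"
  proof
    fix A assume "A \<in> T"
    then obtain a y1 y2 y3 y4 where a: "a \<longlonglongrightarrow> A"
      "\<forall>\<^sub>F n in sequentially. point (real n) (a n) (y1 n) (y2 n) (y3 n) (y4 n)"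
      using even_family_solution_family T by blast
    have "\<forall>\<^sub>F n in sequentially. solution_ratio (int n) (a n)"
      using a(2) eventually_ge_at_top[of 2]
      by eventually_elim (rule point_solution_ratio; simp)
    then show "\<exists>a. a \<longlonglongrightarrow> A \<and> (\<forall>\<^sub>F n in sequentially. solution_ratio (int n) (a n))"
      using a(1) by blast
  qed
  then obtain a where a: "\<And>A. A \<in> T \<Longrightarrow> a A \<longlonglongrightarrow> A"
    "\<And>A. A \<in> T \<Longrightarrow> \<forall>\<^sub>F n in sequentially. solution_ratio (int n) (a A n)"
    by metis
  have "\<forall>\<^sub>F n in sequentially. \<forall>A\<in>T. \<forall>B\<in>T. A \<noteq> B \<longrightarrow> a A n \<noteq> a B n"
  proof (intro eventually_ball_finite ballI T(1))
    fix A B assume AB: "A \<in> T" "B \<in> T"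
    show "\<forall>\<^sub>F n in sequentially. A \<noteq> B \<longrightarrow> a A n \<noteq> a B n"
    proof (cases "A = B")
      case False
      have "(\<lambda>n. a A n - a B n) \<longlonglongrightarrow> A - B" by (intro tendsto_diff a AB)
      then have "\<forall>\<^sub>F n in sequentially. a A n - a B n \<noteq> 0"
        by (rule tendsto_imp_eventually_ne) (use False in simp)
      then show ?thesis by eventually_elim simp
    qed simp
  qed
  moreover have "\<forall>\<^sub>F n in sequentially. \<forall>A\<in>T. solution_ratio (int n) (a A n)"
    by (intro eventually_ball_finite ballI T(1) a)
  ultimately show ?thesis
  proof eventually_elim
    case (elim n)
    have "inj_on (\<lambda>A. a A n) T" using elim by (auto simp: inj_on_def)
    then have "card ((\<lambda>A. a A n) ` T) = k" using T by (simp add: card_image)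
    then show ?case using elim T by (intro exI[of _ "(\<lambda>A. a A n) ` T"]) auto
  qed
qed

lemma not_rat_proportional:
  assumes n: "n = dim_vec v" "dim_vec w = n" and i: "i < n" "j < n"
    and ne: "v $ i * w $ j \<noteq> w $ i * v $ j"
  shows "\<not> rat_proportional v w"
proof
  assume "rat_proportional v w"
  then obtain r where r: "map_vec rat_of_int w = r \<cdot>\<^sub>v map_vec rat_of_int v"
    unfolding rat_proportional_def by blast
  have "of_int (w $ l) = r * of_int (v $ l)" if "l < n" for l
    using arg_cong[OF r, of "\<lambda>u. u $ l"] that n by simp
  then have "rat_of_int (v $ i * w $ j) = of_int (w $ i * v $ j)" using i by simp
  then show False using ne by (simp only: of_int_eq_iff)
qed

lemma at_least_from_ratios:
  fixes sol :: "int vec set"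
  assumes R: "finite R" "card R = k"
    and sol: "\<And>x. x \<in> R \<Longrightarrow> \<exists>v\<in>sol. dim_vec v = n \<and> v $ 1 > 0 \<and> of_int (v $ 0) = of_int (v $ 1) * (x::real)"
    and n: "n > 1"
  shows "at_least_distinct_nonzero k sol"
proof -
  obtain f where f: "\<And>x. x \<in> R \<Longrightarrow> f x \<in> sol \<and> dim_vec (f x) = n \<and> f x $ 1 > 0 \<and>
      of_int (f x $ 0) = of_int (f x $ 1) * x"
    using sol by metis
  have np: "\<not> rat_proportional (f x) (f y)" if xy: "x \<in> R" "y \<in> R" "x \<noteq> y" for x y
  proof (rule not_rat_proportional[of n _ _ 0 1])
    show "f x $ 0 * f y $ 1 \<noteq> f y $ 0 * f x $ 1"
    proof
      assume "f x $ 0 * f y $ 1 = f y $ 0 * f x $ 1"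
      then have "real_of_int (f x $ 0) * of_int (f y $ 1) = of_int (f y $ 0) * of_int (f x $ 1)"
        by (metis of_int_mult)
      then have "of_int (f x $ 1) * of_int (f y $ 1) * x = of_int (f x $ 1) * of_int (f y $ 1) * y"
        using f[OF xy(1)] f[OF xy(2)] by (simp add: mult_ac)
      then show False using f[OF xy(1)] f[OF xy(2)] xy(3) by simp
    qed
  qed (use f xy n in auto)
  have refl: "rat_proportional (f x) (f x)" for x
    unfolding rat_proportional_def by (rule exI[of _ 1]) (auto simp: vec_eq_iff)
  have "inj_on f R" using np refl by (metis inj_onI)
  moreover have "f x \<noteq> 0\<^sub>v (dim_vec (f x))" if "x \<in> R" for x
    using f[OF that] n by (metis index_zero_vec(1) less_irrefl)
  ultimately show ?thesis unfolding at_least_distinct_nonzero_def using f R np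
    by (intro exI[of _ "f ` R"]) (auto simp: card_image pairwise_def)
qed

lemma solutions_from_ratios:
  assumes R: "finite R" "card R = k" "\<forall>x\<in>R. solution_ratio h x"
  shows "at_least_distinct_nonzero k (system8_solutions h)"
    and "at_least_distinct_nonzero k (system6_solutions h)"
proof -
  have "\<exists>v\<in>system8_solutions h. dim_vec v = 8 \<and> v $ 1 > 0 \<and> of_int (v $ 0) = of_int (v $ 1) * x"
    if x: "solution_ratio h x" for x
  proof -
    obtain D X Y1 Y2 Y3 Y4 where d: "D > 0" "of_int X = of_int D * x"
     "F_form (h+3) (h+4) X D 0 D = F_form (h+3) (h+4) Y1 Y2 Y3 Y4"
     "sextic_lhs h X D 0 D Y1 Y2 Y3 Y4 = 0" using x unfolding solution_ratio_def by blast
    then have "vec_of_list [X, D, 0, D, Y1, Y2, Y3, Y4] \<in> system8_solutions h"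
      unfolding system8_solutions_def by blast
    then show ?thesis using d(1,2) by (rule_tac bexI) auto
  qed
  then show "at_least_distinct_nonzero k (system8_solutions h)"
    by (intro at_least_from_ratios[OF R(1,2), of _ 8]) (use R(3) in auto)
  have "\<exists>v\<in>system6_solutions h. dim_vec v = 6 \<and> v $ 1 > 0 \<and> of_int (v $ 0) = of_int (v $ 1) * x"
    if x: "solution_ratio h x" for x
  proof -
    obtain D X Y1 Y2 Y3 Y4 where d: "D > 0" "of_int X = of_int D * x"
     "F_form (h+3) (h+4) X D 0 D = F_form (h+3) (h+4) Y1 Y2 Y3 Y4"
     "sextic_lhs h X D 0 D Y1 Y2 Y3 Y4 = 0" using x unfolding solution_ratio_def by blast
    then have "quartic6 h X D Y1 Y2 Y3 Y4 = 0" "sextic6 h X D Y1 Y2 Y3 Y4 = 0"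
      by (simp_all add: quartic6_def sextic6_def quartic_lhs_def)
    then have "vec_of_list [X, D, Y1, Y2, Y3, Y4] \<in> system6_solutions h"
      unfolding system6_solutions_def by blast
    then show ?thesis using d(1,2) by (rule_tac bexI) auto
  qed
  then show "at_least_distinct_nonzero k (system6_solutions h)"
    by (intro at_least_from_ratios[OF R(1,2), of _ 6]) (use R(3) in auto)
qed

section \<open>Degrees of the two equations\<close>

definition mono_deg :: "(nat \<Rightarrow>\<^sub>0 nat) \<Rightarrow> nat" where
  "mono_deg m = (\<Sum>i\<in>Poly_Mapping.keys m. Poly_Mapping.lookup m i)"

definition deg_le :: "int_mpoly \<Rightarrow> nat \<Rightarrow> bool" where
  "deg_le P d \<longleftrightarrow> (\<forall>m\<in>Poly_Mapping.keys P. mono_deg m \<le> d)"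

text \<open>
  The ideal generated by all variables except number j; modulo it a polynomial is determined by
  its pure powers of that variable.
\<close>

definition involves_other :: "nat \<Rightarrow> int_mpoly \<Rightarrow> bool" where
  "involves_other j P \<longleftrightarrow> (\<forall>m\<in>Poly_Mapping.keys P. \<exists>i. i \<noteq> j \<and> Poly_Mapping.lookup m i \<noteq> 0)"

lemma mono_deg_superset:
  "finite S \<Longrightarrow> Poly_Mapping.keys m \<subseteq> S \<Longrightarrow> mono_deg m = (\<Sum>i\<in>S. Poly_Mapping.lookup m i)"
  unfolding mono_deg_def by (rule sum.mono_neutral_left) (auto simp: in_keys_iff)

lemma mono_deg_add: "mono_deg (a + b) = mono_deg a + mono_deg b"
proof -
  let ?S = "Poly_Mapping.keys a \<union> Poly_Mapping.keys b"
  have "mono_deg (a + b) = (\<Sum>i\<in>?S. Poly_Mapping.lookup (a + b) i)"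
    by (rule mono_deg_superset) (use Poly_Mapping.keys_add[of a b] in auto)
  also have "\<dots> = (\<Sum>i\<in>?S. Poly_Mapping.lookup a i) + (\<Sum>i\<in>?S. Poly_Mapping.lookup b i)"
    by (simp add: lookup_add sum.distrib)
  also have "\<dots> = mono_deg a + mono_deg b"
    by (intro arg_cong2[of _ _ _ _ "(+)"] mono_deg_superset[symmetric]) auto
  finally show ?thesis .
qed

lemma total_deg_eqI:
  assumes "deg_le P d" "m \<in> Poly_Mapping.keys P" "mono_deg m = d"
  shows "total_deg P = d"
proof -
  have "total_deg P = Max (insert 0 (mono_deg ` Poly_Mapping.keys P))"
    by (simp add: total_deg_def mono_deg_def[abs_def])
  also have "\<dots> = d"
    by (rule Max_eqI) (use assms in \<open>auto simp: deg_le_def\<close>)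
  finally show ?thesis .
qed

lemma deg_le_add: "deg_le P d \<Longrightarrow> deg_le Q d \<Longrightarrow> deg_le (P + Q) d"
  unfolding deg_le_def using Poly_Mapping.keys_add[of P Q] by blast

lemma deg_le_uminus: "deg_le P d \<Longrightarrow> deg_le (- P) d"
  unfolding deg_le_def by (simp add: in_keys_iff)

lemma deg_le_diff: "deg_le P d \<Longrightarrow> deg_le Q d \<Longrightarrow> deg_le (P - Q) d"
  using deg_le_add[OF _ deg_le_uminus, of P d Q] by simp

lemma deg_le_mult: "deg_le P a \<Longrightarrow> deg_le Q b \<Longrightarrow> a + b \<le> d \<Longrightarrow> deg_le (P * Q) d"
  unfolding deg_le_def using keys_mult[of P Q] by (fastforce simp: mono_deg_add)

lemma deg_le_zero: "deg_le 0 d" by (simp add: deg_le_def)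

lemma deg_le_one: "deg_le 1 d"
  by (simp add: deg_le_def mono_deg_def flip: single_one)

lemma deg_le_power: "deg_le P a \<Longrightarrow> n * a \<le> d \<Longrightarrow> deg_le (P ^ n) d"
proof (induction n arbitrary: d)
  case 0
  show ?case by (simp add: deg_le_one)
next
  case (Suc n)
  have "deg_le (P ^ n) (n * a)" by (rule Suc.IH) (use Suc.prems in auto)
  then show ?case using deg_le_mult[OF Suc.prems(1), of "P ^ n" "n * a" d] Suc.prems by simp
qed

lemma deg_le_of_nat: "deg_le (of_nat n) d"
  by (induction n) (auto intro: deg_le_zero deg_le_one deg_le_add)

lemma deg_le_of_int: "deg_le (of_int k) d"
  by (cases k) (auto intro!: deg_le_of_nat deg_le_diff deg_le_uminus deg_le_one deg_le_add simp del: of_nat_Suc)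

lemma deg_le_numeral: "deg_le (numeral k) d"
  using deg_le_of_nat[of "numeral k" d] by simp

lemma deg_le_X_var: "1 \<le> d \<Longrightarrow> deg_le (X_var i) d"
  by (simp add: deg_le_def X_var_def mono_deg_def)

lemma deg_le_sum: "(\<And>i. i \<in> S \<Longrightarrow> deg_le (f i) d) \<Longrightarrow> deg_le (sum f S) d"
  by (induction S rule: infinite_finite_induct) (auto intro: deg_le_zero deg_le_add)

lemma deg_le_prod:
  "finite S \<Longrightarrow> (\<And>i. i \<in> S \<Longrightarrow> deg_le (f i) a) \<Longrightarrow> deg_le (prod f S) (card S * a)"
proof (induction S rule: finite_induct)
  case (insert x S)
  then show ?case by (auto intro!: deg_le_mult[of _ a _ "card S * a"])
qed (simp add: deg_le_one)

lemma deg_le_det: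
  assumes "M \<in> carrier_mat n n" "\<And>i j. i < n \<Longrightarrow> j < n \<Longrightarrow> deg_le (M $$ (i,j)) 1"
  shows "deg_le (det M) n"
proof -
  have "deg_le (signof p * (\<Prod>i = 0..<n. M $$ (i, p i))) n" if "p permutes {0..<n}" for p
  proof (rule deg_le_mult[of _ 0 _ n])
    show "deg_le (signof p) 0" by (auto simp: sign_def intro: deg_le_one deg_le_uminus)
    have "deg_le (\<Prod>i\<in>{0..<n}. M $$ (i, p i)) (card {0..<n} * 1)"
      by (rule deg_le_prod) (use assms(2) permutes_in_image[OF that] in auto)
    then show "deg_le (\<Prod>i = 0..<n. M $$ (i, p i)) n" by simp
  qed simp
  then show ?thesis unfolding det_def'[OF assms(1)] by (auto intro!: deg_le_sum)
qed

lemmas deg_le_intros = deg_le_add deg_le_diff deg_le_uminus deg_le_of_int deg_le_numeral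
  deg_le_zero deg_le_one deg_le_X_var

lemma deg_le_A_mat:
  assumes "deg_le p 0" "deg_le q 0" "deg_le x1 1" "deg_le x2 1" "deg_le x3 1" "deg_le x4 1"
    "i < 4" "j < 4"
  shows "deg_le (A_mat p q x1 x2 x3 x4 $$ (i,j)) 1"
proof -
  have scal: "deg_le (c * x) 1" if "deg_le c 0" "deg_le x 1" for c x
    using that by (rule deg_le_mult) simp
  have pq: "deg_le (p * q) 0" by (rule deg_le_mult[OF assms(1,2)]) simp
  have "deg_le (p^2) 0" by (rule deg_le_power[OF assms(1)]) simp
  then have c: "deg_le (p^2 - q) 0" using assms(2) by (rule deg_le_diff)
  note scal = scal[OF assms(1)] scal[OF assms(2)] scal[OF pq] scal[OF c]
  have "i \<in> {0,1,2,3}" "j \<in> {0,1,2,3}" using assms by auto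
  then show ?thesis
    by (elim insertE emptyE)
      (simp_all add: A_mat_def mat_of_rows_list_def deg_le_add deg_le_diff deg_le_uminus
        scal[simplified] assms[simplified])
qed

lemma deg_le_G_vec:
  assumes "deg_le p 0" "deg_le q 0" "deg_le x1 1" "deg_le x2 1" "deg_le x3 1" "deg_le x4 1"
    "deg_le x5 1" "deg_le x6 1" "deg_le x7 1" "deg_le x8 1" and i: "i < 4"
  shows "deg_le (G_vec p q x1 x2 x3 x4 x5 x6 x7 x8 $ i) 4"
proof -
  let ?A = "A_mat p q x1 x2 x3 x4" and ?y = "vec_of_list [x5,x6,x7,x8]"
  have "deg_le (adj_mat ?A $$ (i,j)) 3" if j: "j < 4" for j
  proof -
    have "deg_le (det (mat_delete ?A j i)) 3"
      by (rule deg_le_det) (use i j carrier_matD[OF A_mat_carrier, of p q x1 x2 x3 x4] in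
          \<open>auto simp: mat_delete_def intro!: deg_le_A_mat[simplified] assms[simplified]\<close>)
    moreover have "deg_le ((-1) ^ (j + i)) 0"
      by (rule deg_le_power[of _ 0]) (simp_all add: deg_le_intros)
    moreover have "adj_mat ?A $$ (i,j) = (-1) ^ (j + i) * det (mat_delete ?A j i)"
      using i j carrier_matD[OF A_mat_carrier, of p q x1 x2 x3 x4]
      by (simp add: adj_mat_def cofactor_def)
    ultimately show ?thesis by (auto intro!: deg_le_mult[of _ 0 _ 3])
  qed
  moreover have "deg_le (?y $ j) 1" if "j < 4" for j
    using that assms by (auto simp: vec_of_list_index less_Suc_eq numeral_eq_Suc)
  moreover have "G_vec p q x1 x2 x3 x4 x5 x6 x7 x8 $ i = (\<Sum>j<4. adj_mat ?A $$ (i,j) * ?y $ j)"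
    using i adj_mat(1)[OF A_mat_carrier, of p q x1 x2 x3 x4]
    by (auto simp: G_vec_def scalar_prod_def lessThan_Suc numeral_eq_Suc)
  ultimately show ?thesis by (auto intro!: deg_le_sum deg_le_mult[of _ 3 _ 1])
qed

lemma involves_other_add: "involves_other j P \<Longrightarrow> involves_other j Q \<Longrightarrow> involves_other j (P + Q)"
  unfolding involves_other_def using Poly_Mapping.keys_add[of P Q] by blast

lemma involves_other_uminus: "involves_other j P \<Longrightarrow> involves_other j (- P)"
  unfolding involves_other_def by (simp add: in_keys_iff)

lemma involves_other_diff: "involves_other j P \<Longrightarrow> involves_other j Q \<Longrightarrow> involves_other j (P - Q)"
  using involves_other_add[OF _ involves_other_uminus, of j P Q] by simp

lemma involves_other_mult_left: "involves_other j P \<Longrightarrow> involves_other j (P * Q)"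
  unfolding involves_other_def using keys_mult[of P Q] by (fastforce simp: lookup_add)

lemma involves_other_mult_right: "involves_other j Q \<Longrightarrow> involves_other j (P * Q)"
  using involves_other_mult_left[of j Q P] by (simp add: mult.commute)

lemma involves_other_power: "involves_other j P \<Longrightarrow> n > 0 \<Longrightarrow> involves_other j (P ^ n)"
  by (cases n) (auto intro: involves_other_mult_left)

lemma involves_other_X_var: "i \<noteq> j \<Longrightarrow> involves_other j (X_var i)"
  by (auto simp: involves_other_def X_var_def)

lemma X_var_power: "X_var i ^ n = Poly_Mapping.single (Poly_Mapping.single i n) 1"
  by (induction n) (simp_all add: X_var_def mult_single single_add[symmetric] flip: single_one)

text \<open>The term of top degree is read off modulo the ideal of the other variables.\<close>

lemma lead_key:
  assumes "involves_other j R" "c = 1 \<or> c = -1"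
  shows "Poly_Mapping.single j n \<in> Poly_Mapping.keys (c * X_var j ^ n + R)"
proof -
  have "Poly_Mapping.lookup R (Poly_Mapping.single j n) = 0"
    using assms(1) unfolding involves_other_def by (metis in_keys_iff lookup_single_not_eq)
  then show ?thesis using assms(2)
    by (auto simp: in_keys_iff lookup_add X_var_power)
qed

lemma mono_deg_single: "mono_deg (Poly_Mapping.single j n) = n"
  by (cases "n = 0") (simp_all add: mono_deg_def)

lemma involves_other_zero: "involves_other j 0"
  by (simp add: involves_other_def)

lemma involves_other_F_form:
  assumes "involves_other j b" "involves_other j c" "involves_other j d"
  shows "involves_other j (F_form p q a b c d - a ^ 4)"
proof -
  have add: "involves_other j (P + t - s)" if "involves_other j (P - s)" "involves_other j t" for P t s
    using involves_other_add[OF that] by (simp add: algebra_simps)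
  have diff: "involves_other j (P - t - s)" if "involves_other j (P - s)" "involves_other j t" for P t s
    using involves_other_diff[OF that] by (simp add: algebra_simps)
  have base: "involves_other j (s - s)" for s by (simp add: involves_other_zero)
  show ?thesis unfolding F_form_def
    by (rule base add diff involves_other_mult_right involves_other_power assms | simp)+
qed

lemma deg_le_F_form:
  assumes p: "deg_le p 0" and q: "deg_le q 0"
    and "deg_le a 1" "deg_le b 1" "deg_le c 1" "deg_le d 1"
  shows "deg_le (F_form p q a b c d) 4"
  unfolding F_form_def
  by (rule deg_le_add deg_le_diff deg_le_mult deg_le_power assms deg_le_numeral order_refl | simp)+

lemma total_deg_quartic6:
  "total_deg (quartic6 (of_int h) (X_var 1) (X_var 2) (X_var 5) (X_var 6) (X_var 7) (X_var 8)) = 4"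
  (is "total_deg ?P = 4")
proof (rule total_deg_eqI[OF _ _ mono_deg_single])
  define p q :: int_mpoly where "p = of_int h + 3" and "q = of_int h + 4"
  have pq: "deg_le p 0" "deg_le q 0" by (simp_all add: p_def q_def deg_le_intros)
  show "deg_le ?P 4"
    unfolding quartic6_def quartic_lhs_def p_def[symmetric] q_def[symmetric]
    by (intro deg_le_diff deg_le_F_form pq deg_le_X_var deg_le_zero order_refl)
  have "involves_other 1 ((F_form p q (X_var 1) (X_var 2) 0 (X_var 2) - X_var 1 ^ 4)
     - ((F_form p q (X_var 5) (X_var 6) (X_var 7) (X_var 8) - X_var 5 ^ 4) + X_var 5 ^ 4))"
    by (intro involves_other_diff involves_other_add involves_other_F_form involves_other_X_var
        involves_other_zero involves_other_power) simp_all
  then have "involves_other 1 (?P - X_var 1 ^ 4)"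
    unfolding quartic6_def quartic_lhs_def p_def q_def by (simp add: algebra_simps)
  then show "Poly_Mapping.single 1 4 \<in> Poly_Mapping.keys ?P"
    using lead_key[of 1 "?P - X_var 1 ^ 4" 1 4] by simp
qed

lemma total_deg_sextic6:
  "total_deg (sextic6 (of_int h) (X_var 1) (X_var 2) (X_var 5) (X_var 6) (X_var 7) (X_var 8)) = 6"
  (is "total_deg ?P = 6")
proof (rule total_deg_eqI[OF _ _ mono_deg_single])
  define p q :: int_mpoly where "p = of_int h + 3" and "q = of_int h + 4"
  have pq: "deg_le p 0" "deg_le q 0" by (simp_all add: p_def q_def deg_le_intros)
  define x1 x2 x5 x6 x7 x8 where "x1 = X_var 1" and "x2 = X_var 2" and "x5 = X_var 5"
    and "x6 = X_var 6" and "x7 = X_var 7" and "x8 = X_var 8"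
  note xs = x1_def[symmetric] x2_def[symmetric] x5_def[symmetric] x6_def[symmetric]
    x7_def[symmetric] x8_def[symmetric]
  have X: "deg_le x1 1" "deg_le x2 1" "deg_le x5 1" "deg_le x6 1" "deg_le x7 1" "deg_le x8 1"
    by (simp_all add: x1_def x2_def x5_def x6_def x7_def x8_def deg_le_X_var)
  have Y: "involves_other 1 x2" "involves_other 1 x5" "involves_other 1 x6" "involves_other 1 x7"
     "involves_other 1 x8"
    by (simp_all add: x2_def x5_def x6_def x7_def x8_def involves_other_X_var)
  define F L H where "F = F_form p q x1 x2 0 x2" and "L = x5 - 2*x7 + 2*x8 + of_int h*(x6 - x8)"
    and "H = H_form p q x1 x2 0 x2 x5 x6 x7 x8"
  have P: "?P = F * (- (x1^2) + 3*x2^2 + 31*x2^2 - L^2) + 2 * of_int h * H"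
    unfolding sextic6_def sextic_lhs_def xs F_def L_def H_def p_def q_def by simp
  have G: "deg_le (G_vec p q x1 x2 0 x2 x5 x6 x7 x8 $ i) 4" if "i < 4" for i
    using that by (intro deg_le_G_vec pq X deg_le_zero)
  have dF: "deg_le F 4" unfolding F_def by (intro deg_le_F_form pq X deg_le_zero)
  have dL: "deg_le L 1" unfolding L_def
    by (rule deg_le_add deg_le_diff deg_le_mult deg_le_of_int X deg_le_numeral order_refl | simp)+
  have dH: "deg_le H 6" unfolding H_def H_form_def Let_def
    by (rule deg_le_add deg_le_diff deg_le_uminus deg_le_mult deg_le_power X pq G deg_le_numeral
        order_refl | simp)+
  show "deg_le ?P 6" unfolding P
    by (rule deg_le_add deg_le_diff deg_le_uminus deg_le_mult deg_le_power X dF dL dH deg_le_numeral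
        deg_le_of_int order_refl | simp)+
  have iF: "involves_other 1 (F - x1^4)" unfolding F_def
    by (intro involves_other_F_form Y involves_other_zero)
  have iL: "involves_other 1 L" unfolding L_def
    by (intro involves_other_add involves_other_diff involves_other_mult_right Y)
  note rules = involves_other_add involves_other_diff involves_other_mult_right involves_other_power
  have c: "involves_other 1 (- 2*x5*x6 + 3*x6^2 + 2*p*x6*x7 - 3*p*x6*x8 - 2*q*x7*x8 + 3*q*x8^2)"
    "involves_other 1 (2*x5^2 - 3*x5*x6 - 2*p*x5*x7 + 3*p*x5*x8 + 2*q*x7^2 - 3*q*x7*x8)"
    "involves_other 1 (2*q*(x5*x8 - x6*x7))" "involves_other 1 (3*q*(x5*x8 - x6*x7))"
    by (intro rules Y; simp)+
  have iH: "involves_other 1 H" unfolding H_def H_form_def Let_def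
    by (rule involves_other_diff[OF involves_other_add[OF involves_other_add]];
        rule c[THEN involves_other_mult_left])
  \<comment> \<open>Modulo the other variables, F is x1^4 and its cofactor is - x1^2.\<close>
  have "involves_other 1 (x1^4 * (3*x2^2 + 31*x2^2 - L^2)
      + (F - x1^4) * (- (x1^2) + 3*x2^2 + 31*x2^2 - L^2) + 2 * of_int h * H)"
  proof (intro involves_other_add)
    show "involves_other 1 (x1^4 * (3*x2^2 + 31*x2^2 - L^2))"
      by (intro involves_other_mult_right involves_other_diff involves_other_add
          involves_other_power Y iL) simp_all
    show "involves_other 1 ((F - x1^4) * (- (x1^2) + 3*x2^2 + 31*x2^2 - L^2))"
      by (rule involves_other_mult_left[OF iF])
    show "involves_other 1 (2 * of_int h * H)" by (rule involves_other_mult_right[OF iH])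
  qed
  also have "x1^4 * (3*x2^2 + 31*x2^2 - L^2)
      + (F - x1^4) * (- (x1^2) + 3*x2^2 + 31*x2^2 - L^2) + 2 * of_int h * H = ?P + x1^6"
    unfolding P by (simp add: algebra_simps power_add[symmetric])
  finally have "involves_other 1 (?P + x1^6)" .
  then show "Poly_Mapping.single 1 6 \<in> Poly_Mapping.keys ?P"
    using lead_key[of 1 "?P + x1^6" "-1" 6] by (simp add: x1_def)
qed

section \<open>Arbitrarily many solutions\<close>

lemma infinite_int_of_eventually:
  fixes P :: "int \<Rightarrow> bool"
  assumes "\<forall>\<^sub>F n in sequentially. P (int n)"
  shows "infinite {h. P h}"
proof
  assume "finite {h. P h}"
  then obtain b where b: "\<And>h. P h \<Longrightarrow> h < b"
    by (metis (mono_tags) finite_nat_set_iff_bounded bdd_above_finite bdd_above_def gt_ex le_less_trans mem_Collect_eq)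
  have "\<forall>\<^sub>F n in sequentially. P (int n) \<and> nat b \<le> n"
    using assms eventually_ge_at_top[of "nat b"] by eventually_elim simp
  then obtain n where "P (int n)" "nat b \<le> n"
    by (auto simp: eventually_sequentially)
  then show False using b[of "int n"] by simp
qed

theorem mainTheorem9:
  shows "(\<forall>n::nat. n > 0 \<longrightarrow>
            infinite {h::int. at_least_distinct_nonzero n (system8_solutions h)})
       \<and> (\<forall>n::nat. n > 0 \<longrightarrow>
            infinite {h::int.
              total_deg (quartic6 (of_int h)
                (X_var 1) (X_var 2) (X_var 5) (X_var 6) (X_var 7) (X_var 8)) = 4 \<and>
              total_deg (sextic6 (of_int h)
                (X_var 1) (X_var 2) (X_var 5) (X_var 6) (X_var 7) (X_var 8)) = 6 \<and>
              at_least_distinct_nonzero n (system6_solutions h)})"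
proof -
  have *: "\<forall>\<^sub>F k in sequentially. at_least_distinct_nonzero n (system8_solutions (int k)) \<and>
      at_least_distinct_nonzero n (system6_solutions (int k))" for n
    using many_solution_ratios[of n]
    by eventually_elim (use solutions_from_ratios in blast)
  have "infinite {h. at_least_distinct_nonzero n (system8_solutions h)}" for n
    by (rule infinite_int_of_eventually) (use *[of n] in \<open>auto elim: eventually_mono\<close>)
  moreover have "infinite {h. at_least_distinct_nonzero n (system6_solutions h)}" for n
    by (rule infinite_int_of_eventually) (use *[of n] in \<open>auto elim: eventually_mono\<close>)
  ultimately show ?thesis unfolding total_deg_quartic6 total_deg_sextic6 by simp
qed

end
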